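(* Let $f = f_{\alpha(0)}+\sum_{j=1}^n f_{\alpha(j)} x^{\alpha(j)} +\sum_{\alpha \in \Delta(f)} f_\alpha x^\alpha\in\mathbb{R}[x_1,\dots,x_n]$ be an ST-polynomial in standard form. Assume that for every pair $(\alpha,j) \in \Delta(f)\times \{0,1,\ldots,n\}$ there exists an $a_{\alpha,j} \geq 0$ such that the following holds: (1) $|f_\alpha| \leq \prod_{j\in \mathrm{nz}(\alpha)} \left(\frac{a_{\alpha,j}}{\lambda_j^{(\alpha)}}\right)^{\lambda_j^{(\alpha)}}$ for every $\alpha\in\Delta(f)$; (2) $f_{\alpha(j)}\geq \sum_{\alpha\in \Delta(f)} a_{\alpha,j}$ for all $j = 0,\ldots,n$. Then $f$ is a sum of $|\Delta(f)|$ nonnegative circuit polynomials, which all have faces of $\mathrm{New}(f)$ as Newton polytopes. If in addition $\Delta(f) \subseteq \mathrm{New}(f)^*$, then $f$ is a sum of binomial squares.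
   Context: Notation: $\mathbb{N}$ contains $0$; $x^\alpha = x_1^{\alpha_1}\cdots x_n^{\alpha_n}$; $\mathrm{New}(f)$ is the Newton polytope, i.e. the convex hull of the exponents with nonzero coefficient. A polynomial is nonnegative if it is $\geq 0$ on all of $\mathbb{R}^n$. A lattice point is even if it lies in $(2\mathbb{N})^n$. An ST-polynomial in standard form is a polynomial $f = f_{\alpha(0)}+\sum_{j=1}^n f_{\alpha(j)} x^{\alpha(j)} +\sum_{\alpha \in \Delta} f_\alpha x^\alpha$ such that: (ST1) $\alpha(0)=0$ and $\alpha(1),\ldots,\alpha(n)$ form a set $V$ of affinely independent points in $(2\mathbb{N})^n$. (ST2) $\Delta$ is the set of exponents $\alpha$ in $f$ not defining monomial squares, i.e. $\alpha\in\Delta$ iff $f_\alpha<0$, or $\alpha\notin(2\mathbb{N})^n$ and $f_\alpha>0$. (ST3) $\Delta\subseteq \mathrm{conv}(V)$; equivalently every $\alpha\in\Delta$ is uniquely written $\alpha=\sum_{j=0}^n\lambda_j^{(\alpha)}\alpha(j)$ with $\lambda_j^{(\alpha)}\ge 0$, $\sum_{j=0}^n\lambda_j^{(\alpha)}=1$. (ST4) $f_0 = f_{\alpha(0)},f_{\alpha(1)},\ldots,f_{\alpha(n)}$ are nonnegative, and if $f_{\alpha(j)}=0$ then $\lambda_j^{(\alpha)}=0$ for all $\alpha\in\Delta$. One writes $\Delta(f)=\Delta$ and $\mathrm{nz}(\alpha)=\{j\in\{0,\ldots,n\}:\lambda_j^{(\alpha)}\neq 0\}$. A circuit polynomial is an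 ST-polynomial whose set $\Delta$ is empty or a singleton. A binomial is an expression $rx^\alpha+sx^\beta$ with $r,s\in\mathbb{R}$ (one or both possibly zero); a sum of binomial squares is a finite sum of squares of binomials. For a set $L\subseteq\mathbb{Z}^n$ put $\bar A(L)=\{\frac12(s+t): s,t\in L\cap(2\mathbb{Z})^n,\ s\ne t\}$. For a finite set $P\subset(2\mathbb{Z})^n$ put $P^0=\mathrm{conv}(P)\cap\mathbb{Z}^n$ and $P^{k+1}=\bar A(P^k)\cup P$; this decreasing sequence of finite sets becomes stationary, and its stationary value is denoted $P^*$ (it is the largest set $L$ with $P\subseteq L\subseteq\bar A(L)\cup P$). $\mathrm{New}(f)^*$ denotes $V(f)^*$, where $V(f)$ is the vertex set of $\mathrm{New}(f)$.
   Formalization: When Δ(f) is empty the claim "sum of |Δ(f)| = 0 circuit polynomials" fails (e.g. f = 1 + x²), so the number of summands is taken to be max(1, |Δ(f)|); for nonempty Δ(f) it is exactly |Δ(f)|. *)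

theory Defs
  imports "HOL-Analysis.Analysis" "HOL-Library.Poly_Mapping"
begin

text \<open>
  Variables are indexed by a finite type \<open>'n\<close>, with \<open>n = CARD('n)\<close>. An exponent is a vector in
  \<open>nat ^ 'n\<close>, and a real polynomial is a finitely supported map from exponents to coefficients;
  the multiplication of the type \<open>\<Rightarrow>\<^sub>0\<close> is convolution, i.e. the usual product of polynomials, and
  \<open>Poly_Mapping.single a c\<close> is the monomial \<open>x^a\<close> with coefficient \<open>c\<close>.
\<close>

type_synonym 'n rpoly = "(nat ^ 'n) \<Rightarrow>\<^sub>0 real"

abbreviation pcoeff :: "'n::finite rpoly \<Rightarrow> nat ^ 'n \<Rightarrow> real" where
  "pcoeff \<equiv> Poly_Mapping.lookup"

definition peval :: "'n::finite rpoly \<Rightarrow> real ^ 'n \<Rightarrow> real" where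
  "peval f x = (\<Sum>a\<in>Poly_Mapping.keys f. pcoeff f a * (\<Prod>i\<in>UNIV. (x $ i) ^ (a $ i)))"

definition nonneg_poly :: "'n::finite rpoly \<Rightarrow> bool" where
  "nonneg_poly f \<longleftrightarrow> (\<forall>x. peval f x \<ge> 0)"

definition real_pt :: "nat ^ 'n \<Rightarrow> real ^ 'n::finite" where
  "real_pt a = (\<chi> i. real (a $ i))"

definition int_pt :: "nat ^ 'n \<Rightarrow> int ^ 'n::finite" where
  "int_pt a = (\<chi> i. int (a $ i))"

definition real_of_int_pt :: "int ^ 'n \<Rightarrow> real ^ 'n::finite" where
  "real_of_int_pt p = (\<chi> i. real_of_int (p $ i))"

definition even_exponent :: "nat ^ 'n::finite \<Rightarrow> bool" where
  "even_exponent a \<longleftrightarrow> (\<forall>i. even (a $ i))"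

definition even_lattice :: "(int ^ 'n::finite) set" where
  "even_lattice = {p. \<forall>i. even (p $ i)}"

definition Newton :: "'n::finite rpoly \<Rightarrow> (real ^ 'n) set" where
  "Newton f = convex hull (real_pt ` Poly_Mapping.keys f)"

definition Delta :: "'n::finite rpoly \<Rightarrow> (nat ^ 'n) set" where
  "Delta f = {a. pcoeff f a < 0 \<or> (\<not> even_exponent a \<and> pcoeff f a > 0)}"

text \<open>
  Barycentric coordinates of \<open>b\<close> with respect to \<open>\<alpha> 0, \<dots>, \<alpha> n\<close>. They are unique, hence the
  description is meaningful, when these points are distinct and affinely independent and \<open>b\<close> lies
  in their convex hull; setting \<open>l j = 0\<close> for \<open>j > n\<close> makes the function \<open>l\<close> itself unique.
\<close>

definition bary :: "(nat \<Rightarrow> nat ^ 'n::finite) \<Rightarrow> nat ^ 'n \<Rightarrow> nat \<Rightarrow> real" where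
  "bary \<alpha> b = (THE l. (\<forall>j\<le>CARD('n). l j \<ge> 0) \<and> (\<forall>j>CARD('n). l j = 0) \<and>
     (\<Sum>j\<le>CARD('n). l j) = 1 \<and> real_pt b = (\<Sum>j\<le>CARD('n). l j *\<^sub>R real_pt (\<alpha> j)))"

definition nz :: "(nat \<Rightarrow> nat ^ 'n::finite) \<Rightarrow> nat ^ 'n \<Rightarrow> nat set" where
  "nz \<alpha> b = {j. j \<le> CARD('n) \<and> bary \<alpha> b j \<noteq> 0}"

text \<open>
  The affinely independent set \<open>V\<close> consists of all \<open>n + 1\<close> points \<open>\<alpha> 0, \<dots>, \<alpha> n\<close>; injectivity is
  needed because \<open>affine_dependent\<close> speaks about sets. Some of the coefficients at these points may
  be zero.
\<close>

definition ST_standard :: "'n::finite rpoly \<Rightarrow> (nat \<Rightarrow> nat ^ 'n) \<Rightarrow> bool" where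
  "ST_standard f \<alpha> \<longleftrightarrow>
     f = (\<Sum>j\<le>CARD('n). Poly_Mapping.single (\<alpha> j) (pcoeff f (\<alpha> j)))
         + (\<Sum>b\<in>Delta f. Poly_Mapping.single b (pcoeff f b)) \<and>
     \<alpha> 0 = 0 \<and>
     inj_on \<alpha> {..CARD('n)} \<and>
     \<not> affine_dependent (real_pt ` \<alpha> ` {..CARD('n)}) \<and>
     (\<forall>j\<le>CARD('n). even_exponent (\<alpha> j)) \<and>
     real_pt ` Delta f \<subseteq> convex hull (real_pt ` \<alpha> ` {..CARD('n)}) \<and>
     (\<forall>j\<le>CARD('n). pcoeff f (\<alpha> j) \<ge> 0 \<and>
        (pcoeff f (\<alpha> j) = 0 \<longrightarrow> (\<forall>b\<in>Delta f. bary \<alpha> b j = 0)))"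

text \<open>
  An ST-polynomial with empty \<open>Delta\<close> (a sum of monomial squares) is itself a circuit polynomial.
  Decomposing it into circuit polynomials therefore takes one summand rather than
  \<open>card (Delta f) = 0\<close>, so in general the number of summands is \<open>max 1 (card (Delta f))\<close>.
\<close>

definition circuit_poly :: "'n::finite rpoly \<Rightarrow> bool" where
  "circuit_poly f \<longleftrightarrow> (\<exists>\<alpha>. ST_standard f \<alpha>) \<and> (Delta f = {} \<or> (\<exists>b. Delta f = {b}))"

definition is_binomial :: "'n::finite rpoly \<Rightarrow> bool" where
  "is_binomial g \<longleftrightarrow>
     (\<exists>a b r s. g = Poly_Mapping.single a r + Poly_Mapping.single b s)"

definition sum_of_binomial_squares :: "'n::finite rpoly \<Rightarrow> bool" where
  "sum_of_binomial_squares f \<longleftrightarrow>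
     (\<exists>(m::nat) g. (\<forall>i<m. is_binomial (g i)) \<and> f = (\<Sum>i<m. (g i)\<^sup>2))"

text \<open>The division by 2 below is exact, since \<open>s\<close> and \<open>t\<close> have even entries.\<close>

definition midpoints :: "(int ^ 'n::finite) set \<Rightarrow> (int ^ 'n) set" where
  "midpoints L = {\<chi> i. (s $ i + t $ i) div 2 | s t.
     s \<in> L \<inter> even_lattice \<and> t \<in> L \<inter> even_lattice \<and> s \<noteq> t}"

primrec mediated_seq :: "(int ^ 'n::finite) set \<Rightarrow> nat \<Rightarrow> (int ^ 'n) set" where
  "mediated_seq P 0 = {p. real_of_int_pt p \<in> convex hull (real_of_int_pt ` P)}"
| "mediated_seq P (Suc k) = midpoints (mediated_seq P k) \<union> P"

text \<open>The stationary value of the sequence, which exists for finite subsets of \<open>even_lattice\<close>.\<close>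

definition mediated_star :: "(int ^ 'n::finite) set \<Rightarrow> (int ^ 'n) set" where
  "mediated_star P = (THE L. \<forall>\<^sub>F k in sequentially. mediated_seq P k = L)"

text \<open>Vertices of a Newton polytope are exponents, so taking only integral vertices loses nothing.\<close>

definition Newton_vertices :: "'n::finite rpoly \<Rightarrow> (int ^ 'n) set" where
  "Newton_vertices f = {p. real_of_int_pt p extreme_point_of Newton f}"

definition Newton_star :: "'n::finite rpoly \<Rightarrow> (int ^ 'n) set" where
  "Newton_star f = mediated_star (Newton_vertices f)"

end

theory Submission
  imports Defs
begin

text \<open>
  Write \<open>\<lambda>\<close> for the barycentric coordinates of an inner exponent \<open>b\<close>. The polynomial is cut into one
  circuit \<open>\<Sum>c b j x^(\<alpha> j) + f\<^sub>b x^b\<close> for each \<open>b\<close>, with \<open>c b j \<ge> a b j\<close> and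
  with \<open>\<Sum>c b j = f_(\<alpha> j)\<close> over all \<open>b\<close>; the coefficients of \<open>f\<close> at the vertices exceed the
  sums of the weights \<open>a\<close> by a nonnegative surplus, which one of the circuits receives. Without
  inner exponents the polynomial is a sum of monomial squares and is kept whole. By the product bound
  on \<open>\<bar>f\<^sub>b\<bar>\<close>, the weighted arithmetic-geometric mean inequality makes each circuit nonnegative
  (\<open>circuit_nonneg\<close>). By the same bound, the coefficients at the vertices that span the minimal
  face containing \<open>b\<close> are positive. Hence the Newton polytope of the circuit is the hull of some vertices
  of the simplex \<open>New(f)\<close>, that is, one of its faces (\<open>Newton_face\<close>).

  For sums of binomial squares it suffices to treat each circuit (\<open>mediated_circuit_sobs\<close>). Let \<open>w\<close> be
  the affine function on the simplex with \<open>w(\<alpha> j) = ln (a b j / \<lambda> j)\<close> where \<open>\<lambda> j > 0\<close>, and for exponents \<open>u\<close> put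
  \<open>Q\<^sub>u = \<Sum>\<lambda>\<^sub>j(u) e^w(\<alpha> j) x^(\<alpha> j) - e^w(u) x^u\<close>. If \<open>u\<close> is the midpoint of the even points \<open>s\<close>
  and \<open>t\<close>, then \<open>Q\<^sub>u - (Q\<^sub>s + Q\<^sub>t)/2\<close> is half of the square of \<open>e^(w(s)/2) x^(s/2) - e^(w(t)/2) x^(t/2)\<close>,
  and \<open>Q\<^sub>u\<close> vanishes at the vertices. Membership of \<open>b\<close> in \<open>New(f)\<^sup>*\<close> means that these relations close
  up on a finite set of exponents. Strict convexity of the squared norm makes the resulting
  linear system solvable with nonnegative coefficients (\<open>superharmonic_elimination\<close>), so that every \<open>Q\<^sub>u\<close>
  with \<open>u\<close> even is a sum of binomial squares (\<open>agiform_sobs\<close>). A last midpoint step reaches \<open>b\<close> itself.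
\<close>

section \<open>Polynomials as a real vector space, and their evaluation\<close>

definition monomial_value :: "nat ^ 'n::finite \<Rightarrow> real ^ 'n \<Rightarrow> real" where
  "monomial_value u x = (\<Prod>i\<in>UNIV. (x $ i) ^ (u $ i))"

lemma peval_superset:
  assumes "finite S" "Poly_Mapping.keys f \<subseteq> S"
  shows "peval f x = (\<Sum>u\<in>S. pcoeff f u * monomial_value u x)"
  unfolding peval_def monomial_value_def
  by (rule sum.mono_neutral_left) (use assms in \<open>auto simp: in_keys_iff\<close>)

lemma peval_add: "peval (f + g) x = peval f x + peval g x"
proof -
  let ?S = "Poly_Mapping.keys f \<union> Poly_Mapping.keys g"
  have "Poly_Mapping.keys (f + g) \<subseteq> ?S" by (rule Poly_Mapping.keys_add)
  then show ?thesis
    by (simp add: peval_superset[of ?S] lookup_add sum.distrib distrib_right)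
qed

lemma peval_single: "peval (Poly_Mapping.single u c) x = c * monomial_value u x"
  by (simp add: peval_superset[of "{u}"])

lemma peval_zero: "peval 0 x = 0"
  by (simp add: peval_def)

lemma peval_sum: "peval (\<Sum>i\<in>I. F i) x = (\<Sum>i\<in>I. peval (F i) x)"
  by (induction I rule: infinite_finite_induct) (auto simp: peval_add peval_zero)

lemma monomial_value_even_nonneg:
  assumes "even_exponent u"
  shows "monomial_value u x \<ge> 0"
  using assms unfolding monomial_value_def even_exponent_def
  by (intro prod_nonneg) (simp add: zero_le_even_power)

lemma single_sum_coeff:
  "Poly_Mapping.single u (\<Sum>i\<in>I. c i) = (\<Sum>i\<in>I. Poly_Mapping.single u (c i :: real))"
  by (induction I rule: infinite_finite_induct) (auto simp: single_add)

definition poly_scale :: "real \<Rightarrow> 'n::finite rpoly \<Rightarrow> 'n rpoly" where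
  "poly_scale c f = Poly_Mapping.single 0 c * f"

lemma poly_scale_single: "poly_scale c (Poly_Mapping.single u d) = Poly_Mapping.single u (c * d)"
  by (simp add: poly_scale_def mult_single)

interpretation rpoly: vector_space poly_scale
proof
  show "poly_scale a (x + y) = poly_scale a x + poly_scale a y" for a x and y :: "'n::finite rpoly"
    by (simp add: poly_scale_def distrib_left)
  show "poly_scale (a + b) x = poly_scale a x + poly_scale b x" for a b and x :: "'n::finite rpoly"
    by (simp add: poly_scale_def single_add distrib_right)
  show "poly_scale a (poly_scale b x) = poly_scale (a * b) x" for a b and x :: "'n::finite rpoly"
    by (simp add: poly_scale_def mult.assoc[symmetric] mult_single)
  show "poly_scale 1 x = x" for x :: "'n::finite rpoly"
    by (simp add: poly_scale_def)
qed

section \<open>The cone of sums of binomial squares\<close>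

lemma binomial_square_add:
  assumes "sum_of_binomial_squares f" "is_binomial g"
  shows "sum_of_binomial_squares (f + g\<^sup>2)"
proof -
  obtain m :: nat and h where h: "\<forall>i<m. is_binomial (h i)" "f = (\<Sum>i<m. (h i)\<^sup>2)"
    using assms(1) unfolding sum_of_binomial_squares_def by blast
  have "(\<Sum>i<m. ((h(m := g)) i)\<^sup>2) = f"
    unfolding h(2) by (rule sum.cong) auto
  then have "f + g\<^sup>2 = (\<Sum>i<Suc m. ((h(m := g)) i)\<^sup>2)"
    by simp
  moreover have "\<forall>i<Suc m. is_binomial ((h(m := g)) i)"
    using h(1) assms(2) by auto
  ultimately show ?thesis
    unfolding sum_of_binomial_squares_def by blast
qed

lemma sobs_zero: "sum_of_binomial_squares 0"
  unfolding sum_of_binomial_squares_def by (rule exI[of _ 0]) simp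

lemma sobs_square: "is_binomial g \<Longrightarrow> sum_of_binomial_squares (g\<^sup>2)"
  using binomial_square_add[OF sobs_zero] by simp

lemma sobs_add:
  assumes "sum_of_binomial_squares f" "sum_of_binomial_squares g"
  shows "sum_of_binomial_squares (f + g)"
proof -
  obtain m :: nat and h where h: "\<forall>i<m. is_binomial (h i)" "g = (\<Sum>i<m. (h i)\<^sup>2)"
    using assms(2) unfolding sum_of_binomial_squares_def by blast
  have "k \<le> m \<Longrightarrow> sum_of_binomial_squares (f + (\<Sum>i<k. (h i)\<^sup>2))" for k
  proof (induction k)
    case (Suc k)
    then show ?case
      using binomial_square_add[of "f + (\<Sum>i<k. (h i)\<^sup>2)" "h k"] h(1)
      by (simp add: add.assoc)
  qed (use assms(1) in simp)
  then show ?thesis using h(2) by simp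
qed

lemma sobs_sum:
  assumes "\<And>i. i \<in> I \<Longrightarrow> sum_of_binomial_squares (F i)"
  shows "sum_of_binomial_squares (\<Sum>i\<in>I. F i)"
  using assms
  by (induction I rule: infinite_finite_induct) (auto intro: sobs_add sobs_zero)

text \<open>
  Scaling moves inside the squares, because a nonnegative constant is itself a square.
\<close>

lemma sobs_scale:
  assumes "c \<ge> 0" "sum_of_binomial_squares f"
  shows "sum_of_binomial_squares (poly_scale c f)"
proof -
  obtain m :: nat and h where h: "\<forall>i<m. is_binomial (h i)" "f = (\<Sum>i<m. (h i)\<^sup>2)"
    using assms(2) unfolding sum_of_binomial_squares_def by blast
  have "is_binomial (poly_scale (sqrt c) (h i))" if "i < m" for i
    using h(1) that unfolding is_binomial_def
    by (metis poly_scale_single rpoly.scale_right_distrib)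
  moreover have "poly_scale c ((h i)\<^sup>2) = (poly_scale (sqrt c) (h i))\<^sup>2" for i
  proof -
    have "(Poly_Mapping.single (0 :: nat ^ 'a) (sqrt c))\<^sup>2 = Poly_Mapping.single 0 c"
      using assms(1) by (simp add: power2_eq_square mult_single)
    then show ?thesis
      by (simp add: poly_scale_def power_mult_distrib)
  qed
  ultimately have "poly_scale c f = (\<Sum>i<m. (poly_scale (sqrt c) (h i))\<^sup>2)"
    "\<forall>i<m. is_binomial (poly_scale (sqrt c) (h i))"
    by (simp_all add: h(2) rpoly.scale_sum_right)
  then show ?thesis
    unfolding sum_of_binomial_squares_def by (intro exI[of _ m] exI conjI)
qed

definition half_exponent :: "nat ^ 'n::finite \<Rightarrow> nat ^ 'n" where
  "half_exponent u = (\<chi> i. u $ i div 2)"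

lemma half_exponent_double:
  "even_exponent u \<Longrightarrow> half_exponent u + half_exponent u = u"
  unfolding half_exponent_def even_exponent_def vec_eq_iff
  by (simp, metis dvd_mult_div_cancel mult_2)

lemma half_exponent_midpoint:
  assumes "even_exponent s" "even_exponent t" "s + t = u + u"
  shows "half_exponent s + half_exponent t = u"
  unfolding vec_eq_iff
proof
  fix i
  have "even (s $ i)" "even (t $ i)" "s $ i + t $ i = u $ i + u $ i"
    using assms by (auto simp: even_exponent_def vec_eq_iff)
  then show "(half_exponent s + half_exponent t) $ i = u $ i"
    by (simp add: half_exponent_def) presburger
qed

lemma even_monomial_sobs:
  assumes "even_exponent u" "c \<ge> 0"
  shows "sum_of_binomial_squares (Poly_Mapping.single u c)"
proof -
  let ?h = "Poly_Mapping.single (half_exponent u) (sqrt c)"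
  have "is_binomial ?h"
    unfolding is_binomial_def by (metis add_0_right single_zero)
  moreover have "?h\<^sup>2 = Poly_Mapping.single u c"
    using assms by (simp add: power2_eq_square mult_single half_exponent_double)
  ultimately show ?thesis using sobs_square by metis
qed

text \<open>
  Since \<open>s\<close> and \<open>t\<close> are even, \<open>A x^s + B x^t + 2 r x^u\<close> is a quadratic form in the monomials
  \<open>x^(s/2)\<close> and \<open>x^(t/2)\<close>, whose product is \<open>x^u\<close>. Completing the square gives
  \<open>(\<surd>A x^(s/2) + (r/\<surd>A) x^(t/2))\<^sup>2 + (B - r\<^sup>2/A) x^t\<close>. The sign of \<open>r\<close> is free, which later
  covers odd exponents with a coefficient of either sign.
\<close>

lemma midpoint_trinomial_sobs:
  assumes "even_exponent s" "even_exponent t" "s + t = u + u"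
    and "A > 0" "r\<^sup>2 \<le> A * B"
  shows "sum_of_binomial_squares
    (Poly_Mapping.single s A + Poly_Mapping.single t B + Poly_Mapping.single u (2 * r))"
proof -
  let ?g = "Poly_Mapping.single (half_exponent s) (sqrt A) +
    Poly_Mapping.single (half_exponent t) (r / sqrt A)"
  have "?g\<^sup>2 = Poly_Mapping.single s A + Poly_Mapping.single t (r\<^sup>2 / A)
      + Poly_Mapping.single u (2 * r)"
  proof -
    have "half_exponent s + half_exponent t = u" "half_exponent t + half_exponent s = u"
      using half_exponent_midpoint assms(1-3) by (auto simp: add.commute)
    moreover have "Poly_Mapping.single u (2 * r) = Poly_Mapping.single u r + Poly_Mapping.single u r"
      unfolding mult_2 single_add ..
    ultimately show ?thesis
      using assms(1,2,4)
      by (simp add: power2_eq_square ring_distribs mult_single half_exponent_double add_ac)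
  qed
  moreover have "Poly_Mapping.single t B
      = Poly_Mapping.single t (r\<^sup>2 / A) + Poly_Mapping.single t (B - r\<^sup>2 / A)"
    by (simp add: single_add[symmetric])
  ultimately have eq: "Poly_Mapping.single s A + Poly_Mapping.single t B +
      Poly_Mapping.single u (2 * r) = ?g\<^sup>2 + Poly_Mapping.single t (B - r\<^sup>2 / A)"
    by (simp add: algebra_simps)
  have "is_binomial ?g" unfolding is_binomial_def by blast
  moreover have "B - r\<^sup>2 / A \<ge> 0"
    using assms(4,5) by (simp add: divide_le_eq mult.commute)
  ultimately show ?thesis
    unfolding eq by (intro sobs_add sobs_square even_monomial_sobs assms)
qed

section \<open>Elimination in systems with a strictly superharmonic function\<close>

text \<open>
  Each \<open>Q u\<close> is known, up to an element of the cone \<open>C\<close>, to be a nonnegative combination of the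
  other \<open>Q v\<close>. Reading \<open>p\<close> as the transition weights of a walk on \<open>T\<close>, the strictly superharmonic
  function \<open>h\<close> forces the walk to leave \<open>T\<close>, so that \<open>(I - p)\<^sup>-\<^sup>1\<close> exists and is nonnegative. The proof
  is Gaussian elimination of one unknown \<open>x\<close> after the other: superharmonicity at \<open>x\<close> gives
  \<open>p x x < 1\<close>, hence a positive pivot, and it survives the elimination step for the remaining
  unknowns with the same \<open>h\<close>.
\<close>

lemma superharmonic_elimination:
  fixes scale :: "real \<Rightarrow> 'b::ab_group_add \<Rightarrow> 'b"
  assumes vs: "vector_space scale"
    and C_add: "\<And>x y. x \<in> C \<Longrightarrow> y \<in> C \<Longrightarrow> x + y \<in> C"
    and C_scale: "\<And>c x. c \<ge> 0 \<Longrightarrow> x \<in> C \<Longrightarrow> scale c x \<in> C"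
    and "finite T"
    and "\<And>u v. u \<in> T \<Longrightarrow> v \<in> T \<Longrightarrow> p u v \<ge> 0"
    and "\<And>u. u \<in> T \<Longrightarrow> h u \<ge> (0::real)"
    and "\<And>u. u \<in> T \<Longrightarrow> (\<Sum>v\<in>T. p u v * h v) < h u"
    and "\<And>u. u \<in> T \<Longrightarrow> Q u - (\<Sum>v\<in>T. scale (p u v) (Q v)) \<in> C"
    and "u \<in> T"
  shows "Q u \<in> C"
  using assms(4-)
proof (induction T arbitrary: p u rule: finite_induct)
  case (insert x T)
  interpret vector_space scale by (rule vs)
  define d where "d = 1 - p x x"
  \<comment> \<open>the weights left after the row of \<open>x\<close> has been substituted into the other rows\<close>
  define q where "q = (\<lambda>u v. p u v + p u x * p x v / d)"
  define R where "R = (\<lambda>u. Q u - (\<Sum>v\<in>insert x T. scale (p u v) (Q v)))"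
  have nn: "p u v \<ge> 0" if "u \<in> insert x T" "v \<in> insert x T" for u v
    using insert.prems that by auto
  have hn: "h u \<ge> 0" if "u \<in> insert x T" for u
    using insert.prems that by auto
  have sup: "p u x * h x + (\<Sum>v\<in>T. p u v * h v) < h u" if "u \<in> insert x T" for u
    using insert.prems(3)[OF that] insert.hyps by simp
  have tail: "0 \<le> (\<Sum>v\<in>T. p x v * h v)"
    using nn hn by (intro sum_nonneg mult_nonneg_nonneg) auto
  have "p x x * h x < h x"
    using sup[of x] tail by simp
  with nn[of x x] hn[of x] have hx: "h x > 0" and d: "d > 0"
    unfolding d_def by (auto simp: mult_less_cancel_right1 order_less_le)
  have RC: "R u \<in> C" if "u \<in> insert x T" for u
    using insert.prems(4)[OF that] unfolding R_def .
  have QC: "Q u \<in> C" if u: "u \<in> T" for u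
  proof (rule insert.IH[of q])
    show "q u v \<ge> 0" if "u \<in> T" "v \<in> T" for u v
      using nn[of u v] nn[of u x] nn[of x v] d that unfolding q_def by simp
    show "h u \<ge> 0" if "u \<in> T" for u
      using hn that by simp
    show "(\<Sum>v\<in>T. q u v * h v) < h u" if "u \<in> T" for u
    proof -
      have "(\<Sum>v\<in>T. p x v * h v) \<le> d * h x"
        using sup[of x] unfolding d_def by (simp add: left_diff_distrib)
      then have "p u x / d * (\<Sum>v\<in>T. p x v * h v) \<le> p u x / d * (d * h x)"
        using nn[of u x] d that by (intro mult_left_mono) auto
      then have "p u x / d * (\<Sum>v\<in>T. p x v * h v) \<le> p u x * h x"
        using d by simp
      moreover have "(\<Sum>v\<in>T. q u v * h v)
          = (\<Sum>v\<in>T. p u v * h v) + p u x / d * (\<Sum>v\<in>T. p x v * h v)"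
        unfolding q_def by (simp add: distrib_right sum.distrib sum_distrib_left mult.assoc)
      ultimately show ?thesis
        using sup[of u] that by simp
    qed
    show "Q u - (\<Sum>v\<in>T. scale (q u v) (Q v)) \<in> C" if "u \<in> T" for u
    proof -
      have "scale (p u x / d) (R x)
          = scale (p u x / d) (scale d (Q x) - (\<Sum>v\<in>T. scale (p x v) (Q v)))"
        unfolding R_def d_def using insert.hyps
        by (simp add: scale_left_diff_distrib algebra_simps)
      also have "\<dots> = scale (p u x) (Q x) - (\<Sum>v\<in>T. scale (p u x * p x v / d) (Q v))"
        using d by (simp add: scale_right_diff_distrib scale_sum_right mult.assoc)
      finally have "Q u - (\<Sum>v\<in>T. scale (q u v) (Q v)) = R u + scale (p u x / d) (R x)"
        unfolding R_def q_def using insert.hyps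
        by (simp add: scale_left_distrib sum.distrib algebra_simps)
      moreover have "p u x / d \<ge> 0"
        using nn[of u x] d that by simp
      ultimately show ?thesis
        using RC that C_add C_scale by simp
    qed
  qed (rule u)
  show ?case
  proof (cases "u = x")
    case True
    have "Q x = scale (1 / d) (R x + (\<Sum>v\<in>T. scale (p x v) (Q v)))"
    proof -
      have "R x + (\<Sum>v\<in>T. scale (p x v) (Q v)) = scale d (Q x)"
        unfolding R_def d_def using insert.hyps by (simp add: scale_left_diff_distrib)
      then show ?thesis using d by simp
    qed
    moreover have "R x + (\<Sum>v\<in>S. scale (p x v) (Q v)) \<in> C" if "S \<subseteq> T" "finite S" for S
      using that(2,1)
    proof (induction S rule: finite_induct)
      case (insert y S)
      then have "R x + (\<Sum>v\<in>S. scale (p x v) (Q v)) + scale (p x y) (Q y) \<in> C"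
        using C_add C_scale QC[of y] nn[of x y] by auto
      then show ?case
        using insert.hyps by (simp add: algebra_simps)
    qed (use RC in simp)
    ultimately show ?thesis
      using C_scale[of "1 / d"] d insert.hyps(1) True by simp
  qed (use insert.prems QC in auto)
qed simp

section \<open>Barycentric coordinates\<close>

lemma inj_real_pt: "inj real_pt"
  by (auto simp: inj_def real_pt_def vec_eq_iff)

lemma inj_int_pt: "inj int_pt"
  by (auto simp: inj_def int_pt_def vec_eq_iff)

lemma inj_real_of_int_pt: "inj real_of_int_pt"
  by (auto simp: inj_def real_of_int_pt_def vec_eq_iff)

lemma real_of_int_pt_int_pt: "real_of_int_pt (int_pt u) = real_pt u"
  by (simp add: real_of_int_pt_def int_pt_def real_pt_def)

lemma real_pt_add: "real_pt (u + v) = real_pt u + real_pt v"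
  by (simp add: real_pt_def vec_eq_iff)

lemma real_pt_midpoint:
  assumes "s + t = u + u"
  shows "real_pt u = (1/2) *\<^sub>R real_pt s + (1/2) *\<^sub>R real_pt t"
proof -
  have "real_pt s + real_pt t = real_pt u + real_pt u"
    using assms by (simp add: real_pt_add[symmetric])
  then show ?thesis
    by (simp add: scaleR_add_right[symmetric] del: scaleR_half_double scaleR_add_right)
qed

text \<open>
  The supporting simplex shared by an ST-polynomial and the circuit polynomials it is split into,
  without reference to coefficients.
\<close>

locale lattice_simplex =
  fixes \<alpha> :: "nat \<Rightarrow> nat ^ 'n::finite"
  assumes inj_vertices: "inj_on \<alpha> {..CARD('n)}"
    and independent: "\<not> affine_dependent (real_pt ` \<alpha> ` {..CARD('n)})"
    and even_vertices: "j \<le> CARD('n) \<Longrightarrow> even_exponent (\<alpha> j)"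
begin

definition vertex_hull :: "(real ^ 'n) set" where
  "vertex_hull = convex hull (real_pt ` \<alpha> ` {..CARD('n)})"

lemma inj_real_vertices: "inj_on (real_pt \<circ> \<alpha>) {..CARD('n)}"
  by (rule comp_inj_on[OF inj_vertices inj_on_subset[OF inj_real_pt subset_UNIV]])

lemma sum_vertices: "(\<Sum>x\<in>real_pt ` \<alpha> ` {..CARD('n)}. F x) = (\<Sum>j\<le>CARD('n). F (real_pt (\<alpha> j)))"
  unfolding image_comp using sum.reindex[OF inj_real_vertices, of F] by simp

text \<open>
  Affine independence is a statement about the set of vertices; this transfers it to families
  indexed by \<open>0, \<dots>, n\<close>, the form in which barycentric coordinates are given.
\<close>

lemma affine_coordinates_zero:
  assumes "(\<Sum>j\<le>CARD('n). d j) = 0" "(\<Sum>j\<le>CARD('n). d j *\<^sub>R real_pt (\<alpha> j)) = 0" "i \<le> CARD('n)"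
  shows "d i = 0"
proof -
  let ?inv = "the_inv_into {..CARD('n)} (real_pt \<circ> \<alpha>)"
  have inv: "?inv (real_pt (\<alpha> j)) = j" if "j \<le> CARD('n)" for j
    using the_inv_into_f_f[OF inj_real_vertices, of j] that by simp
  have "sum (d \<circ> ?inv) (real_pt ` \<alpha> ` {..CARD('n)}) = 0"
    "(\<Sum>x\<in>real_pt ` \<alpha> ` {..CARD('n)}. (d \<circ> ?inv) x *\<^sub>R x) = 0"
    unfolding sum_vertices using assms by (simp_all add: inv)
  moreover have "\<nexists>U. sum U (real_pt ` \<alpha> ` {..CARD('n)}) = 0 \<and>
      (\<exists>v\<in>real_pt ` \<alpha> ` {..CARD('n)}. U v \<noteq> 0) \<and>
      (\<Sum>v\<in>real_pt ` \<alpha> ` {..CARD('n)}. U v *\<^sub>R v) = 0"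
    using independent affine_dependent_explicit_finite[of "real_pt ` \<alpha> ` {..CARD('n)}"] by simp
  ultimately have "\<forall>x\<in>real_pt ` \<alpha> ` {..CARD('n)}. (d \<circ> ?inv) x = 0"
    by blast
  then have "d (?inv (real_pt (\<alpha> i))) = 0" using assms(3) by simp
  then show ?thesis using inv[OF assms(3)] by simp
qed

lemma bary_eqI:
  assumes "\<And>j. j \<le> CARD('n) \<Longrightarrow> l j \<ge> 0" "\<And>j. j > CARD('n) \<Longrightarrow> l j = 0"
    and "(\<Sum>j\<le>CARD('n). l j) = 1" "real_pt u = (\<Sum>j\<le>CARD('n). l j *\<^sub>R real_pt (\<alpha> j))"
  shows "bary \<alpha> u = l"
  unfolding bary_def
proof (rule the_equality)
  fix m
  assume m: "(\<forall>j\<le>CARD('n). 0 \<le> m j) \<and> (\<forall>j>CARD('n). m j = 0) \<and>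
     (\<Sum>j\<le>CARD('n). m j) = 1 \<and> real_pt u = (\<Sum>j\<le>CARD('n). m j *\<^sub>R real_pt (\<alpha> j))"
  have "m i - l i = 0" if "i \<le> CARD('n)" for i
    by (rule affine_coordinates_zero[of "\<lambda>j. m j - l j"])
      (use m assms that in \<open>auto simp: sum_subtractf scaleR_left_diff_distrib\<close>)
  then show "m = l"
    using m assms(2) by (metis eq_iff_diff_eq_0 ext not_le)
qed (use assms in auto)

lemma
  assumes "real_pt u \<in> vertex_hull"
  shows bary_nonneg: "\<And>j. j \<le> CARD('n) \<Longrightarrow> bary \<alpha> u j \<ge> 0"
    and bary_outside: "\<And>j. j > CARD('n) \<Longrightarrow> bary \<alpha> u j = 0"
    and bary_sum: "(\<Sum>j\<le>CARD('n). bary \<alpha> u j) = 1"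
    and bary_point: "real_pt u = (\<Sum>j\<le>CARD('n). bary \<alpha> u j *\<^sub>R real_pt (\<alpha> j))"
proof -
  obtain w where w: "\<forall>x\<in>real_pt ` \<alpha> ` {..CARD('n)}. 0 \<le> w x"
    "sum w (real_pt ` \<alpha> ` {..CARD('n)}) = 1"
    "(\<Sum>x\<in>real_pt ` \<alpha> ` {..CARD('n)}. w x *\<^sub>R x) = real_pt u"
    using assms unfolding vertex_hull_def by (subst (asm) convex_hull_finite) auto
  define l where "l = (\<lambda>j. if j \<le> CARD('n) then w (real_pt (\<alpha> j)) else 0)"
  have l: "\<And>j. j \<le> CARD('n) \<Longrightarrow> l j \<ge> 0" "\<And>j. j > CARD('n) \<Longrightarrow> l j = 0"
    "(\<Sum>j\<le>CARD('n). l j) = 1" "real_pt u = (\<Sum>j\<le>CARD('n). l j *\<^sub>R real_pt (\<alpha> j))"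
    using w unfolding sum_vertices l_def by auto
  have "bary \<alpha> u = l" by (rule bary_eqI) (use l in auto)
  then show "\<And>j. j \<le> CARD('n) \<Longrightarrow> bary \<alpha> u j \<ge> 0" "\<And>j. j > CARD('n) \<Longrightarrow> bary \<alpha> u j = 0"
    "(\<Sum>j\<le>CARD('n). bary \<alpha> u j) = 1"
    "real_pt u = (\<Sum>j\<le>CARD('n). bary \<alpha> u j *\<^sub>R real_pt (\<alpha> j))"
    using l by auto
qed

lemma bary_vertex:
  assumes "i \<le> CARD('n)"
  shows "bary \<alpha> (\<alpha> i) = (\<lambda>j. if j = i then 1 else 0)"
  by (rule bary_eqI) (use assms in \<open>auto simp: if_distrib[of "\<lambda>c. c *\<^sub>R _"] cong: if_cong\<close>)

lemma bary_midpoint: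
  assumes "real_pt s \<in> vertex_hull" "real_pt t \<in> vertex_hull" "s + t = u + u"
  shows "bary \<alpha> u j = (bary \<alpha> s j + bary \<alpha> t j) / 2"
proof -
  have "bary \<alpha> u = (\<lambda>j. (1/2) * bary \<alpha> s j + (1/2) * bary \<alpha> t j)"
  proof (rule bary_eqI)
    show "(\<Sum>j\<le>CARD('n). (1/2) * bary \<alpha> s j + (1/2) * bary \<alpha> t j) = 1"
      unfolding sum.distrib sum_distrib_left[symmetric] using bary_sum assms by simp
    show "real_pt u = (\<Sum>j\<le>CARD('n). ((1/2) * bary \<alpha> s j + (1/2) * bary \<alpha> t j) *\<^sub>R real_pt (\<alpha> j))"
      unfolding real_pt_midpoint[OF assms(3)] scaleR_left_distrib sum.distrib
        scaleR_scaleR[symmetric] scaleR_sum_right[symmetric]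
      using bary_point[OF assms(1)] bary_point[OF assms(2)] by simp
  qed (use assms bary_nonneg bary_outside in \<open>auto simp: add_nonneg_nonneg\<close>)
  then show ?thesis by (simp add: add_divide_distrib)
qed

lemma nz_finite: "finite (nz \<alpha> u)"
  unfolding nz_def by simp

lemma nz_iff:
  assumes "real_pt u \<in> vertex_hull"
  shows "j \<in> nz \<alpha> u \<longleftrightarrow> j \<le> CARD('n) \<and> bary \<alpha> u j > 0"
  using bary_nonneg[OF assms] unfolding nz_def by force

lemma sum_nz:
  assumes "\<And>j. j \<le> CARD('n) \<Longrightarrow> bary \<alpha> u j = 0 \<Longrightarrow> F j = 0"
  shows "(\<Sum>j\<in>nz \<alpha> u. F j) = (\<Sum>j\<le>CARD('n). F j)"
  by (rule sum.mono_neutral_left) (use assms in \<open>auto simp: nz_def\<close>)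

end

section \<open>Mediated lattice points\<close>

lemma real_of_int_pt_midpoint:
  assumes "s \<in> even_lattice" "t \<in> even_lattice"
  shows "real_of_int_pt (\<chi> i. (s $ i + t $ i) div 2)
    = (1/2) *\<^sub>R real_of_int_pt s + (1/2) *\<^sub>R real_of_int_pt t"
  using assms by (simp add: even_lattice_def real_of_int_pt_def vec_eq_iff real_of_int_div
      add_divide_distrib)

lemma midpoints_mono: "L \<subseteq> M \<Longrightarrow> midpoints L \<subseteq> midpoints M"
  unfolding midpoints_def by blast

lemma mediated_seq_Suc_subset: "mediated_seq P (Suc k) \<subseteq> mediated_seq P k"
proof (induction k)
  case 0
  have "real_of_int_pt (\<chi> i. (s $ i + t $ i) div 2) \<in> convex hull (real_of_int_pt ` P)"
    if "s \<in> even_lattice" "t \<in> even_lattice" "real_of_int_pt s \<in> convex hull (real_of_int_pt ` P)"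
      "real_of_int_pt t \<in> convex hull (real_of_int_pt ` P)" for s t
    unfolding real_of_int_pt_midpoint[OF that(1,2)]
    by (rule convexD[OF convex_convex_hull]) (use that in auto)
  then have "midpoints (mediated_seq P 0) \<subseteq> mediated_seq P 0"
    unfolding midpoints_def by auto
  moreover have "P \<subseteq> mediated_seq P 0"
    by (auto intro: hull_inc)
  ultimately show ?case by simp
next
  case (Suc k)
  then show ?case
    using midpoints_mono[OF Suc] by auto
qed

lemma mediated_seq_antimono: "k \<le> m \<Longrightarrow> mediated_seq P m \<subseteq> mediated_seq P k"
  using lift_Suc_antimono_le[of "mediated_seq P"] mediated_seq_Suc_subset by metis

lemma finite_lattice_points_bounded:
  assumes "bounded B"
  shows "finite {p :: int ^ 'n::finite. real_of_int_pt p \<in> B}"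
proof -
  obtain r where r: "\<forall>x\<in>B. norm x \<le> r"
    using assms bounded_iff by blast
  have "{p :: int ^ 'n. real_of_int_pt p \<in> B} \<subseteq> vec_lambda ` (UNIV \<rightarrow>\<^sub>E {- \<lceil>r\<rceil>..\<lceil>r\<rceil>})"
  proof
    fix p :: "int ^ 'n"
    assume "p \<in> {p. real_of_int_pt p \<in> B}"
    then have "\<bar>real_of_int_pt p $ i\<bar> \<le> r" for i
      using r component_le_norm_cart[of "real_of_int_pt p" i] by fastforce
    then have "p $ i \<in> {- \<lceil>r\<rceil>..\<lceil>r\<rceil>}" for i
      unfolding real_of_int_pt_def by (simp add: abs_le_iff) (metis ceiling_mono
          ceiling_of_int minus_le_iff of_int_minus)
    then show "p \<in> vec_lambda ` (UNIV \<rightarrow>\<^sub>E {- \<lceil>r\<rceil>..\<lceil>r\<rceil>})"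
      by (intro image_eqI[of _ _ "vec_nth p"]) auto
  qed
  then show ?thesis
    by (rule finite_subset) (intro finite_imageI finite_PiE; simp)
qed

lemma finite_mediated_seq_0: "finite P \<Longrightarrow> finite (mediated_seq P 0)"
  unfolding mediated_seq.simps
  by (intro finite_lattice_points_bounded finite_imp_bounded_convex_hull finite_imageI)

text \<open>
  A decreasing sequence of finite sets is constant from the first index at which the cardinality is
  minimal. The value taken from there on is a fixed point of the recursion, and this equation
  provides the midpoint representations used for the sums of squares.
\<close>

lemma mediated_star_stationary:
  assumes "finite P"
  obtains k where "mediated_star P = mediated_seq P k"
    and "mediated_star P = midpoints (mediated_star P) \<union> P"
proof -
  have fin: "finite (mediated_seq P m)" for m
    using finite_mediated_seq_0[OF assms] mediated_seq_antimono[of 0 m P] finite_subset by blast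
  obtain k where k: "\<And>m. card (mediated_seq P k) \<le> card (mediated_seq P m)"
    using ex_has_least_nat[of "\<lambda>_. True" 0 "\<lambda>m. card (mediated_seq P m)"] by auto
  have stat: "mediated_seq P m = mediated_seq P k" if "m \<ge> k" for m
    using card_seteq[OF fin mediated_seq_antimono[OF that]] k by blast
  then have ev: "\<forall>\<^sub>F m in sequentially. mediated_seq P m = mediated_seq P k"
    unfolding eventually_sequentially by blast
  have star: "mediated_star P = mediated_seq P k"
    unfolding mediated_star_def
  proof (rule the_equality)
    fix L
    assume "\<forall>\<^sub>F m in sequentially. mediated_seq P m = L"
    with ev have "\<forall>\<^sub>F m in sequentially. L = mediated_seq P k"
      by eventually_elim simp
    then show "L = mediated_seq P k" by simp
  qed (rule ev)
  have "mediated_star P = midpoints (mediated_star P) \<union> P"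
    using stat[of "Suc k"] unfolding star by simp
  with star that show ?thesis by blast
qed

lemma int_pt_midpoint:
  assumes "int_pt u = (\<chi> i. (int_pt s $ i + int_pt t $ i) div 2)"
    and "int_pt s \<in> even_lattice" "int_pt t \<in> even_lattice"
  shows "s + t = u + u"
proof -
  have "s $ i + t $ i = u $ i + u $ i" for i
  proof -
    have "int (u $ i) = (int (s $ i) + int (t $ i)) div 2"
      using assms(1) by (simp add: int_pt_def vec_eq_iff)
    moreover have "even (int (s $ i))" "even (int (t $ i))"
      using assms(2,3) by (auto simp: even_lattice_def int_pt_def)
    ultimately show ?thesis by presburger
  qed
  then show ?thesis by (simp add: vec_eq_iff)
qed

section \<open>The Newton polytope of an ST-polynomial\<close>

lemma ST_standard_lattice_simplex: "ST_standard f \<alpha> \<Longrightarrow> lattice_simplex \<alpha>"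
  unfolding ST_standard_def lattice_simplex_def by blast

context lattice_simplex
begin

lemma ST_standard_keys:
  assumes "ST_standard f \<alpha>"
  shows "Poly_Mapping.keys f \<subseteq> \<alpha> ` {j. j \<le> CARD('n) \<and> pcoeff f (\<alpha> j) \<noteq> 0} \<union> Delta f"
proof
  fix u
  assume u: "u \<in> Poly_Mapping.keys f"
  have f: "f = (\<Sum>j\<le>CARD('n). Poly_Mapping.single (\<alpha> j) (pcoeff f (\<alpha> j)))
         + (\<Sum>b\<in>Delta f. Poly_Mapping.single b (pcoeff f b))"
    using assms unfolding ST_standard_def by blast
  show "u \<in> \<alpha> ` {j. j \<le> CARD('n) \<and> pcoeff f (\<alpha> j) \<noteq> 0} \<union> Delta f"
  proof (rule ccontr)
    assume n: "u \<notin> \<alpha> ` {j. j \<le> CARD('n) \<and> pcoeff f (\<alpha> j) \<noteq> 0} \<union> Delta f"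
    have "pcoeff f u \<noteq> 0" using u by (simp add: in_keys_iff)
    then have "\<And>j. j \<le> CARD('n) \<Longrightarrow> \<alpha> j \<noteq> u" using n by blast
    then have "(\<Sum>j\<le>CARD('n). pcoeff (Poly_Mapping.single (\<alpha> j) (pcoeff f (\<alpha> j))) u) = 0"
      by (intro sum.neutral) (auto simp: lookup_single)
    moreover have "(\<Sum>b\<in>Delta f. pcoeff (Poly_Mapping.single b (pcoeff f b)) u) = 0"
      using n by (intro sum.neutral) (auto simp: lookup_single when_def)
    ultimately have "pcoeff f u = 0"
      by (subst f) (simp add: lookup_add lookup_sum)
    with \<open>pcoeff f u \<noteq> 0\<close> show False ..
  qed
qed

text \<open>
  The exponents in \<open>Delta f\<close> contribute no vertices: such a point has zero barycentric coordinates at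
  the vertices whose coefficient vanishes, so it lies in the hull of the other ones.
\<close>

lemma Newton_ST_standard:
  assumes "ST_standard f \<alpha>"
  shows "Newton f = convex hull (real_pt ` \<alpha> ` {j. j \<le> CARD('n) \<and> pcoeff f (\<alpha> j) \<noteq> 0})"
    (is "_ = convex hull (real_pt ` \<alpha> ` ?J)")
proof
  have "\<alpha> ` ?J \<subseteq> Poly_Mapping.keys f" by (auto simp: in_keys_iff)
  then show "convex hull (real_pt ` \<alpha> ` ?J) \<subseteq> Newton f"
    unfolding Newton_def by (intro hull_mono image_mono)
  have "real_pt b \<in> convex hull (real_pt ` \<alpha> ` ?J)" if b: "b \<in> Delta f" for b
  proof -
    have sim: "real_pt b \<in> vertex_hull"
      using assms b unfolding ST_standard_def vertex_hull_def by blast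
    have zero: "bary \<alpha> b j = 0" if "j \<le> CARD('n)" "j \<notin> ?J" for j
      using assms b that unfolding ST_standard_def by blast
    have "(\<Sum>j\<in>?J. bary \<alpha> b j) = 1"
      unfolding bary_sum[OF sim, symmetric]
      by (rule sum.mono_neutral_left) (use zero in auto)
    moreover have "real_pt b = (\<Sum>j\<in>?J. bary \<alpha> b j *\<^sub>R real_pt (\<alpha> j))"
      unfolding bary_point[OF sim]
      by (rule sum.mono_neutral_right) (use zero in auto)
    moreover have "(\<Sum>j\<in>?J. bary \<alpha> b j *\<^sub>R real_pt (\<alpha> j)) \<in> convex hull (real_pt ` \<alpha> ` ?J)"
      by (rule convex_sum) (use calculation(1) bary_nonneg[OF sim] in
          \<open>auto intro!: hull_inc\<close>)
    ultimately show ?thesis by simp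
  qed
  then have "real_pt ` Poly_Mapping.keys f \<subseteq> convex hull (real_pt ` \<alpha> ` ?J)"
    using ST_standard_keys[OF assms] hull_subset[of "real_pt ` \<alpha> ` ?J" convex] by blast
  then show "Newton f \<subseteq> convex hull (real_pt ` \<alpha> ` ?J)"
    unfolding Newton_def by (simp add: hull_minimal)
qed

text \<open>
  The faces of a simplex are exactly the hulls of its vertex subsets.
\<close>

lemma Newton_face:
  assumes "ST_standard f \<alpha>" "ST_standard g \<alpha>"
    and "\<And>j. j \<le> CARD('n) \<Longrightarrow> pcoeff g (\<alpha> j) \<noteq> 0 \<Longrightarrow> pcoeff f (\<alpha> j) \<noteq> 0"
  shows "Newton g face_of Newton f"
proof -
  let ?J = "\<lambda>h. {j. j \<le> CARD('n) \<and> pcoeff h (\<alpha> j) \<noteq> 0}"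
  have "\<not> affine_dependent (real_pt ` \<alpha> ` ?J f)"
    using independent by (rule affine_independent_subset) auto
  moreover have "real_pt ` \<alpha> ` ?J g \<subseteq> real_pt ` \<alpha> ` ?J f"
    using assms(3) by blast
  ultimately show ?thesis
    unfolding Newton_ST_standard[OF assms(1)] Newton_ST_standard[OF assms(2)]
    using face_of_convex_hull_affine_independent by blast
qed

lemma vertex_hull_nonneg:
  assumes "x \<in> vertex_hull"
  shows "x $ i \<ge> 0"
proof -
  have "convex {x :: real ^ 'n. 0 \<le> x $ i}"
    unfolding convex_def by (auto intro!: add_nonneg_nonneg)
  moreover have "real_pt ` \<alpha> ` {..CARD('n)} \<subseteq> {x. 0 \<le> x $ i}"
    by (auto simp: real_pt_def)
  ultimately show ?thesis
    using assms hull_minimal unfolding vertex_hull_def by blast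
qed

text \<open>
  The set \<open>New(f)\<^sup>*\<close> is contained in the Newton polytope, hence in the nonnegative orthant, so its
  points may be regarded as exponents. Its non-vertices are midpoints of two distinct even members.
  They are described here relative to the full vertex set of the simplex, which contains the vertices
  of \<open>New(f)\<close>.
\<close>

lemma Newton_star_exponents:
  assumes "ST_standard f \<alpha>"
  defines "N \<equiv> {u. int_pt u \<in> Newton_star f}"
  shows "finite N"
    and "u \<in> N \<Longrightarrow> real_pt u \<in> vertex_hull"
    and "u \<in> N \<Longrightarrow> u \<notin> \<alpha> ` {..CARD('n)} \<Longrightarrow>
      \<exists>s\<in>N. \<exists>t\<in>N. even_exponent s \<and> even_exponent t \<and> s \<noteq> t \<and> s + t = u + u"
proof -
  have P: "Newton_vertices f \<subseteq> int_pt ` \<alpha> ` {..CARD('n)}"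
  proof
    fix p
    assume "p \<in> Newton_vertices f"
    then have "real_of_int_pt p \<in> real_pt ` \<alpha> ` {j. j \<le> CARD('n) \<and> pcoeff f (\<alpha> j) \<noteq> 0}"
      unfolding Newton_vertices_def Newton_ST_standard[OF assms(1)] mem_Collect_eq
      by (rule extreme_point_of_convex_hull)
    then obtain j where "j \<le> CARD('n)" "real_of_int_pt p = real_of_int_pt (int_pt (\<alpha> j))"
      by (auto simp: real_of_int_pt_int_pt)
    then show "p \<in> int_pt ` \<alpha> ` {..CARD('n)}"
      using injD[OF inj_real_of_int_pt] by blast
  qed
  then have finP: "finite (Newton_vertices f)"
    using finite_subset by blast
  obtain k where k: "Newton_star f = mediated_seq (Newton_vertices f) k"
    "Newton_star f = midpoints (Newton_star f) \<union> Newton_vertices f"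
    using mediated_star_stationary[OF finP] unfolding Newton_star_def by blast
  have sub: "Newton_star f \<subseteq> mediated_seq (Newton_vertices f) 0"
    unfolding k(1) by (rule mediated_seq_antimono) simp
  have "real_of_int_pt ` Newton_vertices f \<subseteq> real_pt ` \<alpha> ` {..CARD('n)}"
    using P by (force simp: real_of_int_pt_int_pt)
  then have hull: "convex hull (real_of_int_pt ` Newton_vertices f) \<subseteq> vertex_hull"
    unfolding vertex_hull_def by (rule hull_mono)
  have star_hull: "real_of_int_pt p \<in> vertex_hull" if "p \<in> Newton_star f" for p
    using that sub hull by auto
  then show "u \<in> N \<Longrightarrow> real_pt u \<in> vertex_hull"
    unfolding N_def real_of_int_pt_int_pt[symmetric] by simp
  have natural: "\<exists>u. p = int_pt u" if "p \<in> Newton_star f" for p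
  proof -
    have "0 \<le> p $ i" for i
      using vertex_hull_nonneg[OF star_hull[OF that], of i] by (simp add: real_of_int_pt_def)
    then have "p = int_pt (\<chi> i. nat (p $ i))"
      by (simp add: int_pt_def vec_eq_iff)
    then show ?thesis ..
  qed
  have "finite (Newton_star f)"
    using finite_subset[OF sub finite_mediated_seq_0[OF finP]] .
  then show "finite N"
    unfolding N_def using finite_vimageI[OF _ inj_int_pt] by (simp add: vimage_def)
  show "\<exists>s\<in>N. \<exists>t\<in>N. even_exponent s \<and> even_exponent t \<and> s \<noteq> t \<and> s + t = u + u"
    if "u \<in> N" "u \<notin> \<alpha> ` {..CARD('n)}"
  proof -
    have "int_pt u \<notin> Newton_vertices f"
      using P that(2) by (auto dest: injD[OF inj_int_pt])
    then have "int_pt u \<in> midpoints (Newton_star f)"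
      using that(1) k(2) unfolding N_def by blast
    then obtain p q where pq: "int_pt u = (\<chi> i. (p $ i + q $ i) div 2)"
      "p \<in> Newton_star f" "p \<in> even_lattice" "q \<in> Newton_star f" "q \<in> even_lattice" "p \<noteq> q"
      unfolding midpoints_def by auto
    obtain s t where st: "p = int_pt s" "q = int_pt t"
      using natural pq by metis
    have "even_exponent s" "even_exponent t"
      using pq(3,5) unfolding st by (auto simp: even_lattice_def int_pt_def even_exponent_def)
    moreover have "s + t = u + u"
      by (rule int_pt_midpoint) (use pq st in auto)
    ultimately show ?thesis
      using pq st unfolding N_def by blast
  qed
qed

end

section \<open>Circuit polynomials over a lattice simplex\<close>

text \<open>
  Jensen's inequality for the exponential function at the points \<open>ln (y j)\<close>. If some \<open>y j\<close> vanishes,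
  so does the left-hand side, because \<open>0 powr w = 0\<close> for every \<open>w\<close>.
\<close>

lemma weighted_am_gm:
  fixes w y :: "'a \<Rightarrow> real"
  assumes "finite J" "\<And>j. j \<in> J \<Longrightarrow> w j \<ge> 0" "sum w J = 1" "\<And>j. j \<in> J \<Longrightarrow> y j \<ge> 0"
  shows "(\<Prod>j\<in>J. y j powr w j) \<le> (\<Sum>j\<in>J. w j * y j)"
proof (cases "\<exists>j\<in>J. y j = 0")
  case True
  then have "(\<Prod>j\<in>J. y j powr w j) = 0"
    using assms(1) by (auto intro!: prod_zero)
  moreover have "(\<Sum>j\<in>J. w j * y j) \<ge> 0"
    using assms by (intro sum_nonneg mult_nonneg_nonneg) auto
  ultimately show ?thesis by simp
next
  case False
  then have pos: "y j > 0" if "j \<in> J" for j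
    using assms(4)[OF that] that by (metis order_less_le)
  have "J \<noteq> {}" using assms(3) by auto
  then have "exp (\<Sum>j\<in>J. w j *\<^sub>R ln (y j)) \<le> (\<Sum>j\<in>J. w j * exp (ln (y j)))"
    using assms by (intro convex_on_sum[OF _ _ exp_convex]) auto
  also have "\<dots> = (\<Sum>j\<in>J. w j * y j)"
    using pos by (intro sum.cong) auto
  also have "exp (\<Sum>j\<in>J. w j *\<^sub>R ln (y j)) = (\<Prod>j\<in>J. y j powr w j)"
    unfolding exp_sum[OF assms(1)] by (rule prod.cong) (use pos in \<open>force simp: powr_def\<close>)+
  finally show ?thesis .
qed

text \<open>
  For \<open>t > 0\<close> this is the addition law of exponents. At \<open>t = 0\<close> it depends on the strict positivity
  of the weights: either all exponents vanish and both sides are \<open>1\<close>, or some factor on the left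
  is \<open>0\<close>, as is the right-hand side.
\<close>

lemma prod_power_powr_mean:
  fixes t :: real
  assumes "t \<ge> 0" "finite J" "\<And>j. j \<in> J \<Longrightarrow> w j > 0" "(\<Sum>j\<in>J. w j * real (e j)) = real m"
  shows "(\<Prod>j\<in>J. (t ^ e j) powr w j) = t ^ m"
proof (cases "t = 0")
  case False
  then have "t > 0" using assms(1) by simp
  then have "(\<Prod>j\<in>J. (t ^ e j) powr w j) = (\<Prod>j\<in>J. t powr (w j * real (e j)))"
    by (intro prod.cong) (auto simp: powr_realpow[symmetric] powr_powr mult.commute)
  also have "\<dots> = t powr real m"
    using powr_sum[OF False, of "\<lambda>j. w j * real (e j)" J] assms(4) by simp
  finally show ?thesis using \<open>t > 0\<close> by (simp add: powr_realpow)
next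
  case True
  have nn: "w j * real (e j) \<ge> 0" if "j \<in> J" for j
    using assms(3)[OF that] by simp
  show ?thesis
  proof (cases "m = 0")
    case m: True
    then have "w j * real (e j) = 0" if "j \<in> J" for j
      using sum_nonneg_0[OF assms(2) nn _ that] assms(4) by simp
    then have "e j = 0" if "j \<in> J" for j
      using assms(3) that by force
    then show ?thesis using m by simp
  next
    case False
    then obtain j where j: "j \<in> J" "e j \<noteq> 0"
      using assms(4) by (metis (mono_tags, lifting) mult_zero_right of_nat_0 of_nat_eq_0_iff sum.neutral)
    then have "(\<Prod>j\<in>J. (t ^ e j) powr w j) = 0"
      using assms(2) True by (intro prod_zero) (auto intro!: bexI[of _ j])
    then show ?thesis using False True by simp
  qed
qed

context lattice_simplex
begin

text \<open>
  Barycentric combinations of exponents become weighted geometric means of monomials. The absolute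
  value appears because \<open>b\<close>, unlike the vertices, need not be even.
\<close>

lemma monomial_geometric_mean:
  assumes "real_pt b \<in> vertex_hull"
  shows "(\<Prod>j\<in>nz \<alpha> b. monomial_value (\<alpha> j) x powr bary \<alpha> b j) = \<bar>monomial_value b x\<bar>"
proof -
  have even: "monomial_value (\<alpha> j) x = (\<Prod>i\<in>UNIV. \<bar>x $ i\<bar> ^ (\<alpha> j $ i))" if "j \<in> nz \<alpha> b" for j
    using even_vertices[of j] that unfolding monomial_value_def nz_def even_exponent_def
    by (simp add: power_even_abs)
  have coord: "(\<Sum>j\<in>nz \<alpha> b. bary \<alpha> b j * real (\<alpha> j $ i)) = real (b $ i)" for i
  proof -
    have "real (b $ i) = (\<Sum>j\<le>CARD('n). bary \<alpha> b j * real (\<alpha> j $ i))"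
      using arg_cong[OF bary_point[OF assms], of "\<lambda>v. v $ i"] by (simp add: real_pt_def)
    then show ?thesis by (subst sum_nz) auto
  qed
  have "(\<Prod>j\<in>nz \<alpha> b. monomial_value (\<alpha> j) x powr bary \<alpha> b j)
      = (\<Prod>j\<in>nz \<alpha> b. \<Prod>i\<in>UNIV. (\<bar>x $ i\<bar> ^ (\<alpha> j $ i)) powr bary \<alpha> b j)"
    by (rule prod.cong) (simp_all add: even prod_powr_distrib)
  also have "\<dots> = (\<Prod>i\<in>UNIV. \<Prod>j\<in>nz \<alpha> b. (\<bar>x $ i\<bar> ^ (\<alpha> j $ i)) powr bary \<alpha> b j)"
    by (rule prod.swap)
  also have "\<dots> = (\<Prod>i\<in>UNIV. \<bar>x $ i\<bar> ^ (b $ i))"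
    by (intro prod.cong prod_power_powr_mean coord nz_finite) (auto simp: nz_iff[OF assms])
  also have "\<dots> = \<bar>monomial_value b x\<bar>"
    by (simp add: monomial_value_def abs_prod power_abs)
  finally show ?thesis .
qed

definition vertex_poly :: "(nat \<Rightarrow> real) \<Rightarrow> 'n rpoly" where
  "vertex_poly c = (\<Sum>j\<le>CARD('n). Poly_Mapping.single (\<alpha> j) (c j))"

lemma coeff_vertex_poly_outside: "u \<notin> \<alpha> ` {..CARD('n)} \<Longrightarrow> pcoeff (vertex_poly c) u = 0"
  unfolding vertex_poly_def lookup_sum lookup_single by (intro sum.neutral) (auto simp: when_def)

lemma coeff_vertex_poly:
  assumes "i \<le> CARD('n)"
  shows "pcoeff (vertex_poly c) (\<alpha> i) = c i"
proof -
  have "(\<Sum>j\<le>CARD('n). c j when \<alpha> j = \<alpha> i) = (\<Sum>j\<le>CARD('n). if j = i then c j else 0)"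
    using inj_onD[OF inj_vertices, of _ i] assms by (intro sum.cong) (auto simp: when_def)
  then show ?thesis
    using assms unfolding vertex_poly_def lookup_sum lookup_single by simp
qed

lemma vertex_poly_add: "vertex_poly (\<lambda>j. c j + d j) = vertex_poly c + vertex_poly d"
  unfolding vertex_poly_def by (simp add: single_add sum.distrib)

lemma vertex_poly_sum: "vertex_poly (\<lambda>j. \<Sum>i\<in>I. c i j) = (\<Sum>i\<in>I. vertex_poly (c i))"
  unfolding vertex_poly_def single_sum_coeff by (rule sum.swap)

lemma vertex_poly_sobs:
  assumes "\<And>j. j \<le> CARD('n) \<Longrightarrow> c j \<ge> 0"
  shows "sum_of_binomial_squares (vertex_poly c)"
  unfolding vertex_poly_def
  by (intro sobs_sum even_monomial_sobs) (use assms even_vertices in auto)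

lemma peval_vertex_poly:
  "peval (vertex_poly c) x = (\<Sum>j\<le>CARD('n). c j * monomial_value (\<alpha> j) x)"
  unfolding vertex_poly_def peval_sum peval_single ..

lemma peval_vertex_poly_mono:
  assumes "\<And>j. j \<le> CARD('n) \<Longrightarrow> a j \<le> c j"
  shows "peval (vertex_poly a) x \<le> peval (vertex_poly c) x"
  unfolding peval_vertex_poly
  by (intro sum_mono mult_right_mono monomial_value_even_nonneg)
    (use assms even_vertices in auto)

text \<open>
  The condition that \<open>c\<close> is positive on \<open>nz \<alpha> b\<close> reflects the definition of ST-polynomials: a vertex with zero
  coefficient must not occur in the barycentric representation of \<open>b\<close>.
\<close>

lemma
  assumes "\<alpha> 0 = 0" "real_pt b \<in> vertex_hull" "b \<notin> \<alpha> ` {..CARD('n)}"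
    and "r < 0 \<or> \<not> even_exponent b \<and> r > 0"
    and "\<And>j. j \<le> CARD('n) \<Longrightarrow> c j \<ge> 0" "\<And>j. j \<in> nz \<alpha> b \<Longrightarrow> c j > 0"
  shows Delta_circuit: "Delta (vertex_poly c + Poly_Mapping.single b r) = {b}"
    and ST_standard_circuit: "ST_standard (vertex_poly c + Poly_Mapping.single b r) \<alpha>"
proof -
  let ?g = "vertex_poly c + Poly_Mapping.single b r"
  have at_vertex: "pcoeff ?g (\<alpha> j) = c j" if "j \<le> CARD('n)" for j
  proof -
    have "b \<noteq> \<alpha> j" using assms(3) that by auto
    then show ?thesis by (simp add: lookup_add lookup_single coeff_vertex_poly that)
  qed
  have at_b: "pcoeff ?g b = r"
    by (simp add: lookup_add coeff_vertex_poly_outside assms(3))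
  have elsewhere: "pcoeff ?g u = 0" if "u \<notin> \<alpha> ` {..CARD('n)}" "u \<noteq> b" for u
    using that by (simp add: lookup_add lookup_single coeff_vertex_poly_outside)
  have "u \<in> Delta ?g \<longleftrightarrow> u = b" for u
  proof (cases "u \<in> \<alpha> ` {..CARD('n)}")
    case True
    then obtain j where "j \<le> CARD('n)" "u = \<alpha> j" by auto
    then show ?thesis
      using at_vertex[of j] assms(3) assms(5)[of j] even_vertices[of j] True by (auto simp: Delta_def)
  next
    case False
    then show ?thesis
      using elsewhere[of u] at_b assms(4) by (auto simp: Delta_def)
  qed
  then show D: "Delta ?g = {b}" by blast
  have "(\<Sum>j\<le>CARD('n). Poly_Mapping.single (\<alpha> j) (pcoeff ?g (\<alpha> j))) = vertex_poly c"
    by (subst (2) vertex_poly_def) (simp add: at_vertex)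
  then have eq: "?g = (\<Sum>j\<le>CARD('n). Poly_Mapping.single (\<alpha> j) (pcoeff ?g (\<alpha> j)))
         + (\<Sum>b\<in>Delta ?g. Poly_Mapping.single b (pcoeff ?g b))"
    unfolding D by (simp add: at_b)
  have zero: "bary \<alpha> b j = 0" if "j \<le> CARD('n)" "c j = 0" for j
    using assms(6)[of j] that unfolding nz_def by auto
  show "ST_standard ?g \<alpha>"
    unfolding ST_standard_def
    by (intro conjI, rule eq)
      (use D assms(1,2,5) inj_vertices independent even_vertices at_vertex zero vertex_hull_def in auto)
qed

text \<open>
  If some weight needed for \<open>b\<close> were zero, the product bounding \<open>\<bar>r\<bar>\<close> would have a zero factor.
\<close>

lemma nz_weights_positive:
  assumes "r \<noteq> 0" "\<And>j. j \<le> CARD('n) \<Longrightarrow> a j \<ge> (0::real)"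
    and "\<bar>r\<bar> \<le> (\<Prod>j\<in>nz \<alpha> b. (a j / bary \<alpha> b j) powr bary \<alpha> b j)" "j \<in> nz \<alpha> b"
  shows "a j > 0"
proof (rule ccontr)
  assume "\<not> a j > 0"
  moreover have "a j \<ge> 0" using assms(2,4) unfolding nz_def by blast
  ultimately have "(\<Prod>j\<in>nz \<alpha> b. (a j / bary \<alpha> b j) powr bary \<alpha> b j) = 0"
    using assms(4) nz_finite by (intro prod_zero) (auto intro!: bexI[of _ j])
  then show False using assms(1,3) by simp
qed

text \<open>
  The weighted arithmetic-geometric mean inequality for the quantities
  \<open>(a j / \<lambda> j) x^(\<alpha> j)\<close> with weights \<open>\<lambda> j\<close>: the sum of the vertex terms dominates
  \<open>\<Prod>(a j / \<lambda> j)^(\<lambda> j) \<sqdot> \<bar>x^b\<bar>\<close>, hence \<open>\<bar>r x^b\<bar>\<close>. Increasing the coefficients of the even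
  vertices from \<open>a\<close> to \<open>c\<close> only helps.
\<close>

lemma circuit_nonneg:
  assumes "real_pt b \<in> vertex_hull"
    and "\<And>j. j \<le> CARD('n) \<Longrightarrow> a j \<ge> 0" "\<And>j. j \<le> CARD('n) \<Longrightarrow> a j \<le> c j"
    and "\<bar>r\<bar> \<le> (\<Prod>j\<in>nz \<alpha> b. (a j / bary \<alpha> b j) powr bary \<alpha> b j)"
  shows "nonneg_poly (vertex_poly c + Poly_Mapping.single b r)"
  unfolding nonneg_poly_def
proof
  fix x :: "real ^ 'n"
  let ?J = "nz \<alpha> b" and ?l = "bary \<alpha> b" and ?M = "\<lambda>u. monomial_value u x"
  have le: "j \<le> CARD('n)" if "j \<in> ?J" for j using that unfolding nz_def by blast
  have nn: "?M (\<alpha> j) \<ge> 0" if "j \<le> CARD('n)" for j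
    using monomial_value_even_nonneg even_vertices that by blast
  have pos: "?l j > 0" if "j \<in> ?J" for j
    using that nz_iff[OF assms(1)] by blast
  have "\<bar>r * ?M b\<bar> \<le> (\<Prod>j\<in>?J. (a j / ?l j) powr ?l j) * \<bar>?M b\<bar>"
    unfolding abs_mult by (intro mult_right_mono assms) simp
  also have "\<dots> = (\<Prod>j\<in>?J. (a j / ?l j * ?M (\<alpha> j)) powr ?l j)"
    unfolding monomial_geometric_mean[OF assms(1), symmetric] prod.distrib[symmetric]
  proof (rule prod.cong)
    fix j
    assume "j \<in> ?J"
    then show "(a j / ?l j) powr ?l j * ?M (\<alpha> j) powr ?l j = (a j / ?l j * ?M (\<alpha> j)) powr ?l j"
      using assms(2) le pos nn by (subst powr_mult) (auto intro!: divide_nonneg_pos)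
  qed simp
  also have "\<dots> \<le> (\<Sum>j\<in>?J. ?l j * (a j / ?l j * ?M (\<alpha> j)))"
  proof (rule weighted_am_gm[OF nz_finite])
    show "sum ?l ?J = 1" using bary_sum[OF assms(1)] by (subst sum_nz) auto
    show "?l j \<ge> 0" if "j \<in> ?J" for j using pos[OF that] by simp
    show "a j / ?l j * ?M (\<alpha> j) \<ge> 0" if "j \<in> ?J" for j
      using pos[OF that] assms(2) nn le[OF that] by simp
  qed
  also have "\<dots> = (\<Sum>j\<in>?J. a j * ?M (\<alpha> j))"
    by (rule sum.cong) (use pos in force)+
  also have "\<dots> \<le> (\<Sum>j\<le>CARD('n). a j * ?M (\<alpha> j))"
    by (rule sum_mono2) (use le nn assms(2) in auto)
  also have "\<dots> \<le> peval (vertex_poly c) x"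
    unfolding peval_vertex_poly[symmetric] by (rule peval_vertex_poly_mono) (rule assms(3))
  finally show "0 \<le> peval (vertex_poly c + Poly_Mapping.single b r) x"
    unfolding peval_add peval_single by linarith
qed

section \<open>Mediated circuits are sums of binomial squares\<close>

text \<open>
  The affine function on the simplex that takes the value \<open>\<omega> j\<close> at the vertex \<open>\<alpha> j\<close>.
\<close>

definition log_weight :: "(nat \<Rightarrow> real) \<Rightarrow> nat ^ 'n \<Rightarrow> real" where
  "log_weight \<omega> u = (\<Sum>j\<le>CARD('n). bary \<alpha> u j * \<omega> j)"

text \<open>
  Reznick's agiform \<open>\<Sum>\<lambda> j x^(\<alpha> j) - x^u\<close> after a positive rescaling of the variables and of the
  polynomial, which multiplies each monomial \<open>x^v\<close> by the exponential of an affine function of \<open>v\<close>.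
  Working with this affine function directly avoids solving for the rescaling.
\<close>

definition agiform :: "(nat \<Rightarrow> real) \<Rightarrow> nat ^ 'n \<Rightarrow> 'n rpoly" where
  "agiform \<omega> u = vertex_poly (\<lambda>j. bary \<alpha> u j * exp (\<omega> j))
    - Poly_Mapping.single u (exp (log_weight \<omega> u))"

lemma agiform_vertex:
  assumes "i \<le> CARD('n)"
  shows "agiform \<omega> (\<alpha> i) = 0"
proof -
  have "log_weight \<omega> (\<alpha> i) = \<omega> i"
    using assms unfolding log_weight_def bary_vertex[OF assms] by (simp add: if_distrib[of "\<lambda>c. c * _"] cong: if_cong)
  moreover have "vertex_poly (\<lambda>j. bary \<alpha> (\<alpha> i) j * exp (\<omega> j)) = Poly_Mapping.single (\<alpha> i) (exp (\<omega> i))"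
    using assms unfolding vertex_poly_def bary_vertex[OF assms]
    by (simp add: if_distrib[of "\<lambda>c. c * _"] if_distrib[of "Poly_Mapping.single _"] cong: if_cong)
  ultimately show ?thesis unfolding agiform_def by simp
qed

lemma log_weight_midpoint:
  assumes "real_pt s \<in> vertex_hull" "real_pt t \<in> vertex_hull" "s + t = u + u"
  shows "log_weight \<omega> s + log_weight \<omega> t = 2 * log_weight \<omega> u"
  unfolding log_weight_def sum.distrib[symmetric] sum_distrib_left
  by (rule sum.cong) (simp_all add: bary_midpoint[OF assms] algebra_simps)

text \<open>
  Barycentric coordinates are affine, so the vertex part of the agiform at a midpoint \<open>u\<close> is the mean
  of those at \<open>s\<close> and \<open>t\<close>. What remains besides the two agiforms are monomials at \<open>s\<close> and \<open>t\<close>, which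
  together with the monomial at \<open>u\<close> form a trinomial in two square roots of monomials.
\<close>

lemma vertex_poly_midpoint:
  assumes "real_pt s \<in> vertex_hull" "real_pt t \<in> vertex_hull" "s + t = u + u"
  shows "vertex_poly (\<lambda>j. bary \<alpha> u j * exp (\<omega> j))
    = poly_scale (1/2) (agiform \<omega> s) + poly_scale (1/2) (agiform \<omega> t)
      + poly_scale (1/2) (Poly_Mapping.single s (exp (log_weight \<omega> s))
          + Poly_Mapping.single t (exp (log_weight \<omega> t)))"
proof -
  have half: "poly_scale (1/2) (vertex_poly c) = vertex_poly (\<lambda>j. c j / 2)" for c
    unfolding vertex_poly_def by (simp add: rpoly.scale_sum_right poly_scale_single)
  have "vertex_poly (\<lambda>j. bary \<alpha> u j * exp (\<omega> j))
    = vertex_poly (\<lambda>j. bary \<alpha> s j * exp (\<omega> j) / 2 + bary \<alpha> t j * exp (\<omega> j) / 2)"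
    by (simp add: bary_midpoint[OF assms] add_divide_distrib distrib_right)
  then show ?thesis
    unfolding agiform_def
    by (simp add: vertex_poly_add half rpoly.scale_right_diff_distrib rpoly.scale_right_distrib)
qed

lemma midpoint_term_sobs:
  assumes "real_pt s \<in> vertex_hull" "real_pt t \<in> vertex_hull" "s + t = u + u"
    and "even_exponent s" "even_exponent t" "\<bar>r\<bar> \<le> exp (log_weight \<omega> u)"
  shows "sum_of_binomial_squares (poly_scale (1/2) (Poly_Mapping.single s (exp (log_weight \<omega> s))
    + Poly_Mapping.single t (exp (log_weight \<omega> t))) + Poly_Mapping.single u r)"
proof -
  have "r\<^sup>2 \<le> (exp (log_weight \<omega> u))\<^sup>2"
    using assms(6) abs_le_square_iff[of r "exp (log_weight \<omega> u)"] by simp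
  also have "\<dots> = exp (log_weight \<omega> s) * exp (log_weight \<omega> t)"
    unfolding exp_add[symmetric] log_weight_midpoint[OF assms(1-3)] by (simp add: exp_double)
  finally have "sum_of_binomial_squares (poly_scale (1/2)
      (Poly_Mapping.single s (exp (log_weight \<omega> s)) + Poly_Mapping.single t (exp (log_weight \<omega> t))
        + Poly_Mapping.single u (2 * r)))"
    using assms(3-5) by (intro sobs_scale midpoint_trinomial_sobs) auto
  then show ?thesis
    by (simp add: rpoly.scale_right_distrib poly_scale_single)
qed

text \<open>
  The parallelogram law: the squared norm is strictly convex, so a large constant minus the squared
  norm is strictly superharmonic for the walk that passes from a point to one of two distinct even
  points of which it is the midpoint.
\<close>

lemma norm_real_pt_midpoint:
  fixes s t u :: "nat ^ 'n"
  assumes "s + t = u + u" "s \<noteq> t"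
  shows "2 * (norm (real_pt u))\<^sup>2 < (norm (real_pt s))\<^sup>2 + (norm (real_pt t))\<^sup>2"
proof -
  have "real_pt s + real_pt t = 2 *\<^sub>R real_pt u"
    using real_pt_midpoint[OF assms(1)] by (simp add: scaleR_right_distrib)
  then have "4 * (norm (real_pt u))\<^sup>2 + (norm (real_pt s - real_pt t))\<^sup>2
      = (norm (real_pt s + real_pt t))\<^sup>2 + (norm (real_pt s - real_pt t))\<^sup>2"
    by (simp add: power_mult_distrib)
  also have "\<dots> = 2 * ((norm (real_pt s))\<^sup>2 + (norm (real_pt t))\<^sup>2)"
    by (simp add: power2_norm_eq_inner inner_simps inner_commute)
  finally have "4 * (norm (real_pt u))\<^sup>2 + (norm (real_pt s - real_pt t))\<^sup>2
      = 2 * ((norm (real_pt s))\<^sup>2 + (norm (real_pt t))\<^sup>2)" .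
  moreover have "(norm (real_pt s - real_pt t))\<^sup>2 > 0"
    using assms(2) injD[OF inj_real_pt, of s t] by auto
  moreover have "2 * A < S + T" if "4 * A + D = 2 * (S + T)" "0 < D" for A D S T :: real
    using that by simp
  ultimately show ?thesis by blast
qed

text \<open>
  By the midpoint relation each agiform at an even non-vertex is the mean of two others plus a
  binomial square, while the agiforms at the vertices vanish. This linear system is solved
  by elimination with the superharmonic function just described.
\<close>

lemma agiform_sobs:
  assumes "finite N" and hull: "\<And>u. u \<in> N \<Longrightarrow> real_pt u \<in> vertex_hull"
    and mediated: "\<And>u. u \<in> N \<Longrightarrow> u \<notin> \<alpha> ` {..CARD('n)} \<Longrightarrow>
      \<exists>s\<in>N. \<exists>t\<in>N. even_exponent s \<and> even_exponent t \<and> s \<noteq> t \<and> s + t = u + u"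
    and "u \<in> N" "even_exponent u"
  shows "sum_of_binomial_squares (agiform \<omega> u)"
proof (cases "u \<in> \<alpha> ` {..CARD('n)}")
  case True
  then show ?thesis using agiform_vertex sobs_zero by force
next
  case False
  \<comment> \<open>the unknowns of the linear system\<close>
  define T where "T = {u \<in> N. even_exponent u \<and> u \<notin> \<alpha> ` {..CARD('n)}}"
  obtain s t where st: "\<And>u. u \<in> T \<Longrightarrow> s u \<in> N \<and> t u \<in> N \<and> even_exponent (s u) \<and>
      even_exponent (t u) \<and> s u \<noteq> t u \<and> s u + t u = u + u"
    using mediated unfolding T_def by (simp only: mem_Collect_eq) metis
  define p :: "nat ^ 'n \<Rightarrow> nat ^ 'n \<Rightarrow> real" where
    "p = (\<lambda>u v. (if v = s u then 1/2 else 0) + (if v = t u then 1/2 else 0))"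
  \<comment> \<open>any upper bound of the squared norms on \<open>N\<close> makes \<open>h\<close> nonnegative\<close>
  define B where "B = (\<Sum>v\<in>N. (norm (real_pt v))\<^sup>2)"
  define h where "h = (\<lambda>u :: nat ^ 'n. B - (norm (real_pt u))\<^sup>2)"
  have finT: "finite T" using assms(1) unfolding T_def by simp
  have hn: "h u \<ge> 0" if "u \<in> N" for u
    unfolding h_def B_def using member_le_sum[of u N "\<lambda>v. (norm (real_pt v))\<^sup>2"] assms(1) that by simp
  have QT: "agiform \<omega> v = 0" if "v \<in> N" "even_exponent v" "v \<notin> T" for v
    using that agiform_vertex unfolding T_def by blast
  have "agiform \<omega> u \<in> {f. sum_of_binomial_squares f}"
  proof (rule superharmonic_elimination[where h = h and p = p, OF rpoly.vector_space_axioms _ _ finT])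
    fix u assume u: "u \<in> T"
    note st = st[OF u]
    show "h u \<ge> 0" using hn u unfolding T_def by simp
    have "(\<Sum>v\<in>T. p u v * h v) = (if s u \<in> T then h (s u) / 2 else 0) + (if t u \<in> T then h (t u) / 2 else 0)"
      unfolding p_def using finT
      by (simp add: distrib_right sum.distrib if_distrib[of "\<lambda>c. c * _"] cong: if_cong)
    also have "\<dots> \<le> h (s u) / 2 + h (t u) / 2"
      using hn st by (intro add_mono) auto
    also have "\<dots> < h u"
    proof -
      have "(B - S) / 2 + (B - R) / 2 < B - A" if "2 * A < S + R" for A R S :: real
        using that by (simp add: field_simps)
      then show ?thesis
        using norm_real_pt_midpoint[of "s u" "t u" u] st unfolding h_def by blast
    qed
    finally show "(\<Sum>v\<in>T. p u v * h v) < h u" .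
    have "(\<Sum>v\<in>T. poly_scale (p u v) (agiform \<omega> v))
        = (if s u \<in> T then poly_scale (1/2) (agiform \<omega> (s u)) else 0)
          + (if t u \<in> T then poly_scale (1/2) (agiform \<omega> (t u)) else 0)"
      unfolding p_def using finT
      by (simp add: rpoly.scale_left_distrib sum.distrib if_distrib[of "\<lambda>c. poly_scale c _"] cong: if_cong)
    also have "\<dots> = poly_scale (1/2) (agiform \<omega> (s u)) + poly_scale (1/2) (agiform \<omega> (t u))"
      using QT[of "s u"] QT[of "t u"] st by simp
    finally have "agiform \<omega> u - (\<Sum>v\<in>T. poly_scale (p u v) (agiform \<omega> v))
      = poly_scale (1/2) (Poly_Mapping.single (s u) (exp (log_weight \<omega> (s u)))
          + Poly_Mapping.single (t u) (exp (log_weight \<omega> (t u))))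
        + Poly_Mapping.single u (- exp (log_weight \<omega> u))"
      using st hull vertex_poly_midpoint[of "s u" "t u" u \<omega>]
      by (subst (1) agiform_def) (simp add: single_uminus)
    then show "agiform \<omega> u - (\<Sum>v\<in>T. poly_scale (p u v) (agiform \<omega> v))
        \<in> {f. sum_of_binomial_squares f}"
      using st hull midpoint_term_sobs[of "s u" "t u" u "- exp (log_weight \<omega> u)" \<omega>] by simp
  next
    show "u \<in> T" using assms(4,5) False unfolding T_def by simp
  qed (auto simp: p_def intro: sobs_add sobs_scale)
  then show ?thesis by simp
qed

text \<open>
  Choose \<open>\<omega> j = ln (a j / \<lambda> j)\<close>, so that the agiform at \<open>b\<close> has the vertex coefficients \<open>a j\<close> for
  \<open>j \<in> nz \<alpha> b\<close>, zero at the other vertices, and the inner coefficient \<open>- \<Prod>(a j / \<lambda> j)^(\<lambda> j)\<close>. As \<open>b\<close> may be odd and \<open>r\<close> may have either sign and be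
  smaller than that product, only the two even points \<open>s\<close> and \<open>t\<close> with midpoint \<open>b\<close> enter as
  agiforms, and the trinomial at \<open>s\<close>, \<open>t\<close>, \<open>b\<close> is treated on its own. The surplus of \<open>c\<close> over these
  vertex coefficients consists of monomial squares.
\<close>

lemma mediated_circuit_sobs:
  assumes "finite N" and hull: "\<And>u. u \<in> N \<Longrightarrow> real_pt u \<in> vertex_hull"
    and mediated: "\<And>u. u \<in> N \<Longrightarrow> u \<notin> \<alpha> ` {..CARD('n)} \<Longrightarrow>
      \<exists>s\<in>N. \<exists>t\<in>N. even_exponent s \<and> even_exponent t \<and> s \<noteq> t \<and> s + t = u + u"
    and "b \<in> N" "b \<notin> \<alpha> ` {..CARD('n)}"
    and "r \<noteq> 0" "\<And>j. j \<le> CARD('n) \<Longrightarrow> a j \<ge> 0" "\<And>j. j \<le> CARD('n) \<Longrightarrow> a j \<le> c j"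
    and "\<bar>r\<bar> \<le> (\<Prod>j\<in>nz \<alpha> b. (a j / bary \<alpha> b j) powr bary \<alpha> b j)"
  shows "sum_of_binomial_squares (vertex_poly c + Poly_Mapping.single b r)"
proof -
  define \<omega> where "\<omega> = (\<lambda>j. ln (a j / bary \<alpha> b j))"
  have bhull: "real_pt b \<in> vertex_hull" using assms(2,4) by blast
  have pos: "a j > 0" "bary \<alpha> b j > 0" if "j \<in> nz \<alpha> b" for j
    using nz_weights_positive[OF assms(6,7,9) that] that nz_iff[OF bhull] by auto
  have "exp (log_weight \<omega> b) = exp (\<Sum>j\<in>nz \<alpha> b. bary \<alpha> b j * \<omega> j)"
    unfolding log_weight_def by (subst sum_nz) auto
  also have "\<dots> = (\<Prod>j\<in>nz \<alpha> b. (a j / bary \<alpha> b j) powr bary \<alpha> b j)"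
    unfolding exp_sum[OF nz_finite] \<omega>_def
    by (rule prod.cong) (use pos in \<open>force simp: powr_def\<close>)+
  finally have r: "\<bar>r\<bar> \<le> exp (log_weight \<omega> b)"
    using assms(9) by simp
  obtain s t where st: "s \<in> N" "t \<in> N" "even_exponent s" "even_exponent t" "s + t = b + b"
    using mediated assms(4,5) by blast
  have "sum_of_binomial_squares (poly_scale (1/2) (agiform \<omega> s) + poly_scale (1/2) (agiform \<omega> t)
      + (poly_scale (1/2) (Poly_Mapping.single s (exp (log_weight \<omega> s))
          + Poly_Mapping.single t (exp (log_weight \<omega> t))) + Poly_Mapping.single b r))"
    using st hull agiform_sobs[OF assms(1-3)] r
    by (intro sobs_add sobs_scale midpoint_term_sobs) auto
  then have "sum_of_binomial_squares
      (vertex_poly (\<lambda>j. bary \<alpha> b j * exp (\<omega> j)) + Poly_Mapping.single b r)"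
    using st hull vertex_poly_midpoint[of s t b \<omega>] by (simp add: add.assoc)
  moreover have "bary \<alpha> b j * exp (\<omega> j) \<le> c j" if "j \<le> CARD('n)" for j
  proof (cases "j \<in> nz \<alpha> b")
    case True
    then show ?thesis using pos[OF True] assms(8)[OF that] by (simp add: \<omega>_def)
  next
    case False
    then have "bary \<alpha> b j = 0" using that unfolding nz_def by simp
    then show ?thesis using assms(7,8)[OF that] by simp
  qed
  then have "sum_of_binomial_squares (vertex_poly (\<lambda>j. c j - bary \<alpha> b j * exp (\<omega> j)))"
    by (intro vertex_poly_sobs) simp
  ultimately have "sum_of_binomial_squares (vertex_poly (\<lambda>j. c j - bary \<alpha> b j * exp (\<omega> j))
      + (vertex_poly (\<lambda>j. bary \<alpha> b j * exp (\<omega> j)) + Poly_Mapping.single b r))"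
    by (rule sobs_add[rotated])
  then show ?thesis
    unfolding add.assoc[symmetric] vertex_poly_add[symmetric] by simp
qed

end

section \<open>The decomposition\<close>

theorem theorem3p1:
  fixes f :: "'n::finite rpoly"
    and \<alpha> :: "nat \<Rightarrow> nat ^ 'n"
    and a :: "nat ^ 'n \<Rightarrow> nat \<Rightarrow> real"
  assumes "ST_standard f \<alpha>"
    and "\<forall>b\<in>Delta f. \<forall>j\<le>CARD('n). a b j \<ge> 0"
    and "\<forall>b\<in>Delta f. \<bar>pcoeff f b\<bar> \<le> (\<Prod>j\<in>nz \<alpha> b. (a b j / bary \<alpha> b j) powr bary \<alpha> b j)"
    and "\<forall>j\<le>CARD('n). pcoeff f (\<alpha> j) \<ge> (\<Sum>b\<in>Delta f. a b j)"
  shows "(\<exists>g :: nat \<Rightarrow> 'n rpoly.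
            f = (\<Sum>i<max 1 (card (Delta f)). g i) \<and>
            (\<forall>i<max 1 (card (Delta f)).
               circuit_poly (g i) \<and> nonneg_poly (g i) \<and> Newton (g i) face_of Newton f))
         \<and> (int_pt ` Delta f \<subseteq> Newton_star f \<longrightarrow> sum_of_binomial_squares f)"
proof -
  interpret lattice_simplex \<alpha>
    using assms(1) by (rule ST_standard_lattice_simplex)
  have f: "f = vertex_poly (\<lambda>j. pcoeff f (\<alpha> j))
      + (\<Sum>b\<in>Delta f. Poly_Mapping.single b (pcoeff f b))"
    using assms(1) unfolding ST_standard_def vertex_poly_def by blast
  have fnn: "pcoeff f (\<alpha> j) \<ge> 0" if "j \<le> CARD('n)" for j
    using assms(1) that unfolding ST_standard_def by blast
  show ?thesis
  proof (cases "Delta f = {}")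
    case True
    then have v: "f = vertex_poly (\<lambda>j. pcoeff f (\<alpha> j))" using f by simp
    have "circuit_poly f" using assms(1) True unfolding circuit_poly_def by blast
    moreover have "nonneg_poly f"
      unfolding nonneg_poly_def
    proof
      fix x
      have "peval (vertex_poly (\<lambda>j. pcoeff f (\<alpha> j))) x \<ge> 0"
        unfolding peval_vertex_poly
        by (intro sum_nonneg mult_nonneg_nonneg monomial_value_even_nonneg)
          (use fnn even_vertices in auto)
      then show "0 \<le> peval f x" using v by simp
    qed
    moreover have "Newton f face_of Newton f"
      unfolding Newton_def by (simp add: face_of_refl)
    moreover have "sum_of_binomial_squares f"
      using vertex_poly_sobs[of "\<lambda>j. pcoeff f (\<alpha> j)"] fnn v by simp
    ultimately show ?thesis
      using True by (auto intro!: exI[of _ "\<lambda>_. f"])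
  next
    case False
    have "Delta f \<subseteq> Poly_Mapping.keys f"
      unfolding Delta_def by (auto simp: in_keys_iff)
    then have fin: "finite (Delta f)" by (rule finite_subset) simp
    obtain b0 where b0: "b0 \<in> Delta f" using False by blast
    \<comment> \<open>the surplus of \<open>f\<close> over all the weights \<open>a\<close> is given to one arbitrary circuit \<open>b0\<close>\<close>
    define c where "c = (\<lambda>b j. a b j +
      (if b = b0 then pcoeff f (\<alpha> j) - (\<Sum>b'\<in>Delta f. a b' j) else 0))"
    define G where "G = (\<lambda>b. vertex_poly (c b) + Poly_Mapping.single b (pcoeff f b))"
    have csum: "(\<Sum>b\<in>Delta f. c b j) = pcoeff f (\<alpha> j)" for j
      unfolding c_def using fin b0 by (simp add: sum.distrib)
    have fG: "f = (\<Sum>b\<in>Delta f. G b)"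
      unfolding G_def sum.distrib vertex_poly_sum[symmetric] csum by (rule f)
    have coeff: "pcoeff f b < 0 \<or> \<not> even_exponent b \<and> pcoeff f b > 0" if "b \<in> Delta f" for b
      using that unfolding Delta_def by blast
    have hull: "real_pt b \<in> vertex_hull" if "b \<in> Delta f" for b
      using assms(1) that unfolding ST_standard_def vertex_hull_def by blast
    have outside: "b \<notin> \<alpha> ` {..CARD('n)}" if "b \<in> Delta f" for b
      using coeff[OF that] fnn even_vertices by fastforce
    have ann: "a b j \<ge> 0" if "b \<in> Delta f" "j \<le> CARD('n)" for b j
      using assms(2) that by blast
    have ac: "a b j \<le> c b j" if "j \<le> CARD('n)" for b j
      using assms(4) that unfolding c_def by simp
    have bound: "\<bar>pcoeff f b\<bar> \<le> (\<Prod>j\<in>nz \<alpha> b. (a b j / bary \<alpha> b j) powr bary \<alpha> b j)"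
      if "b \<in> Delta f" for b
      using assms(3) that by blast
    have apos: "a b j > 0" if "b \<in> Delta f" "j \<in> nz \<alpha> b" for b j
    proof (rule nz_weights_positive[of "pcoeff f b" "a b" b j])
      show "pcoeff f b \<noteq> 0" using coeff[OF that(1)] by auto
    qed (use that ann bound in auto)
    have cnn: "c b j \<ge> 0" if "b \<in> Delta f" "j \<le> CARD('n)" for b j
      using ann[OF that] ac[OF that(2), of b] by simp
    have cpos: "c b j > 0" if "b \<in> Delta f" "j \<in> nz \<alpha> b" for b j
      using apos[OF that] ac[of j b] that(2) unfolding nz_def by fastforce
    have zero: "\<alpha> 0 = 0" using assms(1) unfolding ST_standard_def by blast
    have ST: "ST_standard (G b) \<alpha>" if b: "b \<in> Delta f" for b
      unfolding G_def
      by (rule ST_standard_circuit[OF zero hull[OF b] outside[OF b] coeff[OF b] cnn[OF b] cpos[OF b]])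
    have DG: "Delta (G b) = {b}" if b: "b \<in> Delta f" for b
      unfolding G_def
      by (rule Delta_circuit[OF zero hull[OF b] outside[OF b] coeff[OF b] cnn[OF b] cpos[OF b]])
    have circuit: "circuit_poly (G b)" if "b \<in> Delta f" for b
      using ST[OF that] DG[OF that] unfolding circuit_poly_def by blast
    have nonneg: "nonneg_poly (G b)" if "b \<in> Delta f" for b
      unfolding G_def by (rule circuit_nonneg[where a = "a b"]) (use that hull ann ac bound in auto)
    have face: "Newton (G b) face_of Newton f" if b: "b \<in> Delta f" for b
    proof (rule Newton_face[OF assms(1) ST[OF b]])
      fix j
      assume j: "j \<le> CARD('n)" "pcoeff (G b) (\<alpha> j) \<noteq> 0"
      have "b \<noteq> \<alpha> j" using outside[OF b] j(1) by auto
      then have "c b j \<noteq> 0"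
        using j unfolding G_def by (simp add: lookup_add lookup_single coeff_vertex_poly)
      then have "0 < c b j" using cnn[OF b j(1)] by simp
      \<comment> \<open>all summands are nonnegative, so a vertex of the summand cannot cancel in \<open>f\<close>\<close>
      also have "c b j \<le> (\<Sum>b\<in>Delta f. c b j)"
        by (rule member_le_sum) (use b cnn[OF _ j(1)] fin in auto)
      finally show "pcoeff f (\<alpha> j) \<noteq> 0"
        using csum[of j] by simp
    qed
    obtain e where e: "bij_betw e {0..<card (Delta f)} (Delta f)"
      using ex_bij_betw_nat_finite[OF fin] by blast
    have m: "max 1 (card (Delta f)) = card (Delta f)"
      using False fin by (simp add: Suc_le_eq card_gt_0_iff max_def)
    have "f = (\<Sum>i<card (Delta f). G (e i))"
      using sum.reindex_bij_betw[OF e, of G] fG by (simp add: atLeast0LessThan)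
    moreover have "e i \<in> Delta f" if "i < card (Delta f)" for i
      using bij_betwE[OF e] that by simp
    ultimately have "\<exists>g. f = (\<Sum>i<max 1 (card (Delta f)). g i) \<and>
        (\<forall>i<max 1 (card (Delta f)).
           circuit_poly (g i) \<and> nonneg_poly (g i) \<and> Newton (g i) face_of Newton f)"
      unfolding m using circuit nonneg face by (intro exI[of _ "\<lambda>i. G (e i)"]) blast
    moreover have "sum_of_binomial_squares f" if star: "int_pt ` Delta f \<subseteq> Newton_star f"
    proof (subst fG, rule sobs_sum)
      fix b
      assume b: "b \<in> Delta f"
      have nonzero: "pcoeff f b \<noteq> 0" using coeff[OF b] by auto
      show "sum_of_binomial_squares (G b)"
        unfolding G_def
        by (rule mediated_circuit_sobs[where N = "{u. int_pt u \<in> Newton_star f}" and a = "a b"])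
          (use Newton_star_exponents[OF assms(1)] b star outside nonzero ann ac bound in auto)
    qed
    ultimately show ?thesis by blast
  qed
qed

end
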